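(* Let $d\ge1$ and let $\mathcal K$ be a finite simplicial complex with two monotone weight functions $f,f':\mathcal K\to\mathbb R$. Let $\mathcal B_f=\{B_i\}$ and $\mathcal D_f=\{D_i\}$ be the multisets of birth times in the $H_d$ persistence diagram and of death times in the $H_{d-1}$ persistence diagram of $(\mathcal K,f)$, respectively, and let $\mathcal B_{f'}=\{B_i'\}$, $\mathcal D_{f'}=\{D_i'\}$ be the corresponding multisets for $f'$. Let $\Pi_D$ be the set of bijections (of multisets) from $\mathcal D_f$ to $\mathcal D_{f'}$ and $\Pi_B$ the set of bijections from $\mathcal B_f$ to $\mathcal B_{f'}$. Then, for every $p\in\{0,1,2,\dots\}\cup\{\infty\}$, $$\max\Big\{\inf_{\pi\in\Pi_D}\sum_i|D_i-\pi(D_i)|^p,\ \inf_{\pi\in\Pi_B}\sum_i|B_i-\pi(B_i)|^p\Big\}\ \le\ \sum_{\sigma\in\mathcal F^d(\mathcal K)}|f(\sigma)-f'(\sigma)|^p,$$ where for $p=\infty$ an expression $\sum_i|x_i|^p$ is to be read as $\sup_i|x_i|$.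
   Context: Fix a field $\mathbb F$. A simplicial complex on a finite vertex set is a collection of nonempty subsets (faces) closed under taking nonempty subsets; a face $\sigma$ has dimension $|\sigma|-1$; $\mathcal F^d(\mathcal K)$ is the set of $d$-faces. $\beta_j(\cdot)$ is the rank of the $j$-th reduced simplicial homology with coefficients in $\mathbb F$. A weight function $w:\mathcal K\to\mathbb R$ is monotone if $w(\sigma)\le w(\tau)$ whenever $\sigma\subset\tau$ (equivalently, its sublevel sets form a filtration of $\mathcal K$ by subcomplexes). Given monotone $w$, fix a total order $<_l$ on the faces such that $w(\sigma)<w(\tau)$ implies $\sigma<_l\tau$ and every face is preceded by its proper faces; list the faces as $\sigma_1<_l\dots<_l\sigma_N$ and put $\mathcal K_0=\emptyset$, $\mathcal K_i=\{\sigma_1,\dots,\sigma_i\}$. For a $d$-face $\sigma_i$ exactly one of the following holds: (negative) $\beta_{d-1}(\mathcal K_i)=\beta_{d-1}(\mathcal K_{i-1})-1$, or (positive) $\beta_d(\mathcal K_i)=\beta_d(\mathcal K_{i-1})+1$. The death times of the $H_{d-1}$ persistence diagram of $(\mathcal K,w)$ are the multiset $\{w(\sigma):\sigma \text{ a negative } d\text{-face}\}$, and the birth times of the $H_d$ persistence diagram are the multiset $\{w(\sigma):\sigma\text{ a positive }d\text{-face}\}$. (Zero-length bars are thus counted.) For $p=0$ the convention is $0^0=0$ and $|x|^0=1$ for $x\ne0$. *)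

theory Defs
  imports
    Complex_Main
    "HOL-Library.Function_Algebras"
    "HOL-Library.Multiset"
    "HOL-Library.Extended_Nat"
    "HOL-Library.Extended_Nonnegative_Real"
begin

section \<open>Simplicial complexes and weight functions\<close>

definition simplicial_complex :: "'v set set \<Rightarrow> bool" where
  "simplicial_complex K \<longleftrightarrow>
     finite K \<and> (\<forall>\<sigma>\<in>K. finite \<sigma> \<and> \<sigma> \<noteq> {}) \<and>
     (\<forall>\<sigma>\<in>K. \<forall>\<tau>. \<tau> \<noteq> {} \<and> \<tau> \<subseteq> \<sigma> \<longrightarrow> \<tau> \<in> K)"

definition face_dim :: "'v set \<Rightarrow> int" where
  "face_dim \<sigma> = int (card \<sigma>) - 1"

definition faces :: "'v set set \<Rightarrow> int \<Rightarrow> 'v set set" where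
  "faces K d = {\<sigma> \<in> K. face_dim \<sigma> = d}"

definition monotone_weight :: "'v set set \<Rightarrow> ('v set \<Rightarrow> real) \<Rightarrow> bool" where
  "monotone_weight K w \<longleftrightarrow> (\<forall>\<sigma>\<in>K. \<forall>\<tau>\<in>K. \<sigma> \<subset> \<tau> \<longrightarrow> w \<sigma> \<le> w \<tau>)"


section \<open>Reduced simplicial homology with field coefficients\<close>

text \<open>Simplices are oriented by one total order on the whole vertex type, chosen once and for all,
  so that the chain complexes of a complex and of its subcomplexes are compatible.\<close>

definition vertex_order :: "'v rel" where
  "vertex_order = (SOME r. linear_order r)"

lemma linear_order_vertex_order: "linear_order (vertex_order :: 'v rel)"
proof -
  obtain r :: "'v rel" where "well_order_on UNIV r"
    using well_order_on by blast
  then have "linear_order r"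
    by (simp add: well_order_on_def)
  then show ?thesis
    unfolding vertex_order_def by (rule someI)
qed

definition vertex_pos :: "'v \<Rightarrow> 'v set \<Rightarrow> nat" where
  "vertex_pos v \<sigma> = card {u \<in> \<sigma>. u \<noteq> v \<and> (u, v) \<in> vertex_order}"

text \<open>A chain is a coefficient function on faces. The chain group in degree \<open>-1\<close> is spanned by the
  empty face, which is not an element of the complex; this makes the homology reduced.\<close>

definition chains :: "'v set set \<Rightarrow> int \<Rightarrow> ('v set \<Rightarrow> 'k::field) set" where
  "chains K j = {c. \<forall>\<sigma>. c \<sigma> \<noteq> 0 \<longrightarrow> \<sigma> \<in> faces (insert {} K) j}"

text \<open>\<open>\<partial>[v\<^sub>0,\<dots>,v\<^sub>j] = \<Sum>\<^sub>i (-1)\<^sup>i [v\<^sub>0,\<dots>,v\<^sub>i\<^sub>-\<^sub>1,v\<^sub>i\<^sub>+\<^sub>1,\<dots>,v\<^sub>j]\<close>\<close>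

definition face_boundary :: "'v set \<Rightarrow> ('v set \<Rightarrow> 'k::field)" where
  "face_boundary \<sigma> = (\<lambda>\<tau>. \<Sum>v\<in>\<sigma>. if \<tau> = \<sigma> - {v} then (- 1) ^ vertex_pos v \<sigma> else 0)"

definition boundary :: "'v set set \<Rightarrow> ('v set \<Rightarrow> 'k::field) \<Rightarrow> ('v set \<Rightarrow> 'k)" where
  "boundary K c = (\<lambda>\<tau>. \<Sum>\<sigma>\<in>K. c \<sigma> * face_boundary \<sigma> \<tau>)"

definition cycles :: "'v set set \<Rightarrow> int \<Rightarrow> ('v set \<Rightarrow> 'k::field) set" where
  "cycles K j = {c \<in> chains K j. boundary K c = (\<lambda>_. 0)}"

definition boundaries :: "'v set set \<Rightarrow> int \<Rightarrow> ('v set \<Rightarrow> 'k::field) set" where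
  "boundaries K j = boundary K ` chains K (j + 1)"

definition chain_scale :: "'k::field \<Rightarrow> ('v set \<Rightarrow> 'k) \<Rightarrow> ('v set \<Rightarrow> 'k)" where
  "chain_scale a c = (\<lambda>\<sigma>. a * c \<sigma>)"

global_interpretation chain: vector_space chain_scale
  by unfold_locales (auto simp: chain_scale_def fun_eq_iff algebra_simps)

text \<open>The rank of the quotient of the cycles by the boundaries; the quotient itself is not a type.
  The first argument only selects the coefficient field.\<close>

definition betti :: "'k::field itself \<Rightarrow> 'v set set \<Rightarrow> int \<Rightarrow> int" where
  "betti _ K j =
     int (chain.dim (cycles K j :: ('v set \<Rightarrow> 'k) set)) -
     int (chain.dim (boundaries K j :: ('v set \<Rightarrow> 'k) set))"


section \<open>Birth and death times\<close>

text \<open>A total order on the faces is given by the list of faces in increasing order.\<close>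

definition face_order :: "'v set set \<Rightarrow> ('v set \<Rightarrow> real) \<Rightarrow> 'v set list \<Rightarrow> bool" where
  "face_order K w L \<longleftrightarrow>
     distinct L \<and> set L = K \<and>
     (\<forall>i<length L. \<forall>j<length L. w (L ! i) < w (L ! j) \<or> L ! i \<subset> L ! j \<longrightarrow> i < j)"

text \<open>Faces are numbered from \<open>0\<close>, so \<open>set (take i L)\<close> is the complex just before the
  face \<open>L ! i\<close> is added.\<close>

definition negative_faces :: "'k::field itself \<Rightarrow> 'v set list \<Rightarrow> int \<Rightarrow> 'v set set" where
  "negative_faces k L d = {L ! i | i. i < length L \<and> face_dim (L ! i) = d \<and>
     betti k (set (take (Suc i) L)) (d - 1) = betti k (set (take i L)) (d - 1) - 1}"

definition positive_faces :: "'k::field itself \<Rightarrow> 'v set list \<Rightarrow> int \<Rightarrow> 'v set set" where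
  "positive_faces k L d = {L ! i | i. i < length L \<and> face_dim (L ! i) = d \<and>
     betti k (set (take (Suc i) L)) d = betti k (set (take i L)) d + 1}"

text \<open>Death times in the diagram of \<open>H\<^sub>j\<close> come from negative \<open>(j+1)\<close>-faces.\<close>

definition death_times ::
  "'k::field itself \<Rightarrow> ('v set \<Rightarrow> real) \<Rightarrow> 'v set list \<Rightarrow> int \<Rightarrow> real multiset" where
  "death_times k w L j = image_mset w (mset_set (negative_faces k L (j + 1)))"

definition birth_times ::
  "'k::field itself \<Rightarrow> ('v set \<Rightarrow> real) \<Rightarrow> 'v set list \<Rightarrow> int \<Rightarrow> real multiset" where
  "birth_times k w L j = image_mset w (mset_set (positive_faces k L j))"


section \<open>Matching costs\<close>

text \<open>A bijection of multisets is a bijection of the sets of copies \<open>(x, 0), (x, 1), \<dots>\<close> of their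
  elements, counted with multiplicity.\<close>

definition copies :: "'a multiset \<Rightarrow> ('a \<times> nat) set" where
  "copies M = {(x, n). n < count M x}"

definition mset_bijections :: "'a multiset \<Rightarrow> 'b multiset \<Rightarrow> ('a \<times> nat \<Rightarrow> 'b \<times> nat) set" where
  "mset_bijections M N = {\<pi>. bij_betw \<pi> (copies M) (copies N)}"

text \<open>The sum of \<open>|x\<^sub>i|\<^sup>p\<close>, with \<open>0\<^sup>0 = 0\<close>, and the supremum of \<open>|x\<^sub>i|\<close> for \<open>p = \<infinity>\<close>. In
  \<^typ>\<open>ennreal\<close> the supremum over the empty set is \<open>0\<close>, and the infimum of the empty set of
  costs (no bijection) is \<open>\<infinity>\<close>.\<close>

definition power_sum :: "enat \<Rightarrow> 'i set \<Rightarrow> ('i \<Rightarrow> real) \<Rightarrow> ennreal" where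
  "power_sum p I x = (case p of
      enat n \<Rightarrow> (\<Sum>i\<in>I. if x i = 0 then 0 else ennreal (\<bar>x i\<bar> ^ n))
    | \<infinity> \<Rightarrow> (SUP i\<in>I. ennreal \<bar>x i\<bar>))"

definition matching_cost :: "enat \<Rightarrow> real multiset \<Rightarrow> real multiset \<Rightarrow> ennreal" where
  "matching_cost p M N =
     (INF \<pi>\<in>mset_bijections M N. power_sum p (copies M) (\<lambda>a. fst a - fst (\<pi> a)))"

end

theory Submission
  imports Defs
begin

text \<open>
  Adding a \<open>d\<close>-face \<open>\<sigma>\<close> to a filtration kills a class in degree \<open>d - 1\<close> if \<open>\<partial>\<sigma>\<close> is linearly
  independent of the boundaries of the earlier \<open>d\<close>-faces, and creates a class in degree \<open>d\<close>
  otherwise. Let \<open>\<rho> A\<close> be the rank of the boundaries of a set \<open>A\<close> of \<open>d\<close>-faces. Then exactly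
  \<open>\<rho> {f \<le> s}\<close> death times are at most \<open>s\<close>, and for the birth times the same holds with the nullity
  \<open>card A - \<rho> A\<close> in place of the rank. Everything else concerns a finite set with two weight
  functions \<open>f\<close>, \<open>f'\<close> and a set function \<open>\<rho>\<close> that vanishes on the empty set, goes up by \<open>0\<close> or \<open>1\<close>
  when an element is added, and is submodular (the rank) or supermodular (the nullity).

  For \<open>p \<ge> 1\<close> and for \<open>p = \<infinity>\<close> the two multisets are matched in increasing order. The number of
  matched pairs that jump from at most \<open>s\<close> to above \<open>t\<close> is the positive part of
  \<open>\<rho> {f \<le> s} - \<rho> {f' \<le> t}\<close>, hence at most the number of faces with \<open>f \<le> s\<close> and \<open>f' > t\<close>
  (\<open>crossings_level_multisets\<close>). Since \<open>(max 0 (y - x))\<^sup>p\<close> is a nonnegative combination of the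
  indicators of \<open>x \<le> s \<and> t < y\<close> with \<open>s \<le> t\<close> (\<open>gap_power_as_sum_of_thresholds\<close>, by convexity),
  this comparison of counts sums up to the inequality of costs. For \<open>p = \<infinity>\<close> the counts bound the
  largest gap directly.

  For \<open>p = 0\<close> the cost is not convex. Here it suffices that changing the weight of a single face
  replaces at most one element of the multiset (\<open>level_multiset_change_one\<close>, by sub- or
  supermodularity), because the number of unmatched elements satisfies the triangle inequality.
\<close>


section \<open>Matchings of multisets\<close>

lemma count_image_mset_set:
  "finite A \<Longrightarrow> count (image_mset f (mset_set A)) x = card {a \<in> A. f a = x}"
  by (simp add: count_image_mset' eq_commute)

lemma bij_betw_of_equal_fibres:
  assumes "finite A" "finite B"
    and "image_mset f (mset_set A) = image_mset g (mset_set B)"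
  obtains h where "bij_betw h A B" "\<And>a. a \<in> A \<Longrightarrow> g (h a) = f a"
proof -
  have "\<exists>h. bij_betw h {a \<in> A. f a = x} {b \<in> B. g b = x}" for x
  proof (rule finite_same_card_bij)
    have "count (image_mset f (mset_set A)) x = count (image_mset g (mset_set B)) x"
      using assms(3) by simp
    then show "card {a \<in> A. f a = x} = card {b \<in> B. g b = x}"
      using assms(1,2) by (simp add: count_image_mset_set)
  qed (use assms in auto)
  then obtain h where h: "\<And>x. bij_betw (h x) {a \<in> A. f a = x} {b \<in> B. g b = x}"
    by metis
  define k where "k = (\<lambda>a. h (f a) a)"
  have k: "k a \<in> B" "g (k a) = f a" if "a \<in> A" for a
    using bij_betwE[OF h[of "f a"]] that by (auto simp: k_def)
  have "inj_on k A"
  proof (rule inj_onI)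
    fix a a' assume *: "a \<in> A" "a' \<in> A" "k a = k a'"
    then have "f a = f a'"
      using k(2) by metis
    then show "a = a'"
      using * bij_betw_imp_inj_on[OF h[of "f a"]] by (auto simp: k_def inj_on_def)
  qed
  moreover have "k ` A = B"
  proof
    show "B \<subseteq> k ` A"
    proof
      fix b assume "b \<in> B"
      then have "b \<in> h (g b) ` {a \<in> A. f a = g b}"
        using bij_betw_imp_surj_on[OF h[of "g b"]] by simp
      then obtain a where "a \<in> A" "f a = g b" "b = h (g b) a"
        by blast
      then have "b = k a"
        by (simp add: k_def)
      then show "b \<in> k ` A"
        using \<open>a \<in> A\<close> by blast
    qed
  qed (use k in auto)
  ultimately show ?thesis
    using k that by (auto simp: bij_betw_def)
qed

lemma copies_eq_Sigma: "copies M = (SIGMA x:set_mset M. {..<count M x})"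
  by (auto simp: copies_def) (metis count_inI not_less_zero)

lemma finite_copies: "finite (copies M)"
  by (auto simp: copies_eq_Sigma)

lemma image_fst_copies: "image_mset fst (mset_set (copies M)) = M"
proof (rule multiset_eqI)
  fix x
  have "{a \<in> copies M. fst a = x} = Pair x ` {..<count M x}"
    by (auto simp: copies_def)
  then have "card {a \<in> copies M. fst a = x} = count M x"
    by (simp add: card_image inj_on_def)
  then show "count (image_mset fst (mset_set (copies M))) x = count M x"
    by (simp add: count_image_mset_set finite_copies)
qed

lemma image_mset_copies: "image_mset (\<lambda>a. g (fst a)) (mset_set (copies M)) = image_mset g M"
  using arg_cong[OF image_fst_copies[of M], of "image_mset g"]
  by (simp only: image_mset.compositionality comp_def)

text \<open>A multiset of pairs is a bijection between its two projections: both are matched, copy by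
  copy, with the copies of the pairs.\<close>

lemma bijection_of_pairing:
  obtains \<pi> where "\<pi> \<in> mset_bijections (image_mset fst P) (image_mset snd P)"
    and "image_mset (\<lambda>a. (fst a, fst (\<pi> a))) (mset_set (copies (image_mset fst P))) = P"
proof -
  let ?M = "image_mset fst P" and ?N = "image_mset snd P"
  obtain h where h: "bij_betw h (copies ?M) (copies P)" "\<And>a. a \<in> copies ?M \<Longrightarrow> fst (fst (h a)) = fst a"
  proof (rule bij_betw_of_equal_fibres)
    show "image_mset fst (mset_set (copies ?M)) = image_mset (\<lambda>b. fst (fst b)) (mset_set (copies P))"
      by (simp only: image_fst_copies image_mset_copies)
  qed (use finite_copies that in auto)
  obtain h' where h': "bij_betw h' (copies P) (copies ?N)" "\<And>b. b \<in> copies P \<Longrightarrow> fst (h' b) = snd (fst b)"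
  proof (rule bij_betw_of_equal_fibres)
    show "image_mset (\<lambda>b. snd (fst b)) (mset_set (copies P)) = image_mset fst (mset_set (copies ?N))"
      by (simp only: image_fst_copies image_mset_copies)
  qed (use finite_copies that in auto)
  have hP: "h a \<in> copies P" if "a \<in> copies ?M" for a
    using bij_betwE[OF h(1)] that by blast
  show ?thesis
  proof
    show "h' \<circ> h \<in> mset_bijections ?M ?N"
      using bij_betw_trans[OF h(1) h'(1)] by (simp add: mset_bijections_def)
    have "image_mset (\<lambda>a. (fst a, fst ((h' \<circ> h) a))) (mset_set (copies ?M)) = image_mset (\<lambda>a. fst (h a)) (mset_set (copies ?M))"
      by (rule image_mset_cong) (auto simp: finite_copies prod_eq_iff h(2) h'(2)[OF hP])
    also have "\<dots> = image_mset fst (image_mset h (mset_set (copies ?M)))"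
      by (simp add: image_mset.compositionality comp_def)
    also have "image_mset h (mset_set (copies ?M)) = mset_set (copies P)"
      using h(1) by (simp add: bij_betw_def image_mset_mset_set)
    finally show "image_mset (\<lambda>a. (fst a, fst ((h' \<circ> h) a))) (mset_set (copies ?M)) = P"
      by (simp add: image_fst_copies)
  qed
qed

lemma matching_cost_le_sum:
  "matching_cost (enat n) (image_mset fst P) (image_mset snd P)
     \<le> (\<Sum>(x, y)\<in>#P. if x = y then 0 else ennreal (\<bar>x - y\<bar> ^ n))"
proof -
  obtain \<pi> where \<pi>: "\<pi> \<in> mset_bijections (image_mset fst P) (image_mset snd P)"
    "image_mset (\<lambda>a. (fst a, fst (\<pi> a))) (mset_set (copies (image_mset fst P))) = P"
    by (rule bijection_of_pairing)
  have "matching_cost (enat n) (image_mset fst P) (image_mset snd P)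
      \<le> power_sum (enat n) (copies (image_mset fst P)) (\<lambda>a. fst a - fst (\<pi> a))"
    unfolding matching_cost_def by (rule INF_lower[OF \<pi>(1)])
  also have "\<dots> = (\<Sum>(x, y)\<in>#image_mset (\<lambda>a. (fst a, fst (\<pi> a))) (mset_set (copies (image_mset fst P))).
      if x = y then 0 else ennreal (\<bar>x - y\<bar> ^ n))"
    by (simp add: power_sum_def sum_unfold_sum_mset image_mset.compositionality comp_def)
  finally show ?thesis
    unfolding \<pi>(2) .
qed

lemma matching_cost_infinity_le:
  assumes "\<And>x y. (x, y) \<in># P \<Longrightarrow> ennreal \<bar>x - y\<bar> \<le> C"
  shows "matching_cost \<infinity> (image_mset fst P) (image_mset snd P) \<le> C"
proof -
  obtain \<pi> where \<pi>: "\<pi> \<in> mset_bijections (image_mset fst P) (image_mset snd P)"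
    "image_mset (\<lambda>a. (fst a, fst (\<pi> a))) (mset_set (copies (image_mset fst P))) = P"
    by (rule bijection_of_pairing)
  have "(fst a, fst (\<pi> a)) \<in># P" if "a \<in> copies (image_mset fst P)" for a
    using that finite_copies[of "image_mset fst P"] by (subst \<pi>(2)[symmetric]) auto
  then have "power_sum \<infinity> (copies (image_mset fst P)) (\<lambda>a. fst a - fst (\<pi> a)) \<le> C"
    using assms by (auto simp: power_sum_def intro!: SUP_least)
  then show ?thesis
    unfolding matching_cost_def using \<pi>(1) by (rule INF_lower2[rotated])
qed

lemma size_Diff_commute:
  fixes M N :: "'a multiset"
  assumes "size M = size N"
  shows "size (M - N) = size (N - M)"
proof -
  have "M = (M \<inter># N) + (M - N)" "N = (M \<inter># N) + (N - M)"
    by (auto simp: multiset_eq_iff)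
  from this[THEN arg_cong, of size] show ?thesis
    using assms by simp
qed

text \<open>Every common element is matched with itself.\<close>

lemma matching_cost_0_le:
  assumes "size M = size N"
  shows "matching_cost (enat 0) M N \<le> of_nat (size (M - N))"
proof -
  obtain xs where xs: "mset xs = M - N"
    using ex_mset by blast
  obtain ys where ys: "mset ys = N - M"
    using ex_mset by blast
  have M: "M = (M \<inter># N) + (M - N)" and N: "N = (M \<inter># N) + (N - M)"
    by (auto simp: multiset_eq_iff)
  have len: "length xs = length ys"
    using size_Diff_commute[OF assms] by (simp add: xs ys flip: size_mset)
  define P where "P = image_mset (\<lambda>x. (x, x)) (M \<inter># N) + mset (zip xs ys)"
  have "image_mset fst P = M"
    by (subst M) (simp add: P_def image_mset.compositionality comp_def len mset_map[symmetric] xs del: mset_map)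
  moreover have "image_mset snd P = N"
    by (subst N) (simp add: P_def image_mset.compositionality comp_def len mset_map[symmetric] ys del: mset_map)
  moreover have "(\<Sum>(x, y)\<in>#P. if x = y then 0 else ennreal (\<bar>x - y\<bar> ^ 0)) \<le> of_nat (size (M - N))"
  proof -
    have "(\<Sum>(x, y)\<in>#P. if x = y then 0 else ennreal (\<bar>x - y\<bar> ^ 0))
      = (\<Sum>(x, y)\<in>#mset (zip xs ys). if x = y then 0 else 1)"
      by (simp add: P_def image_mset.compositionality comp_def case_prod_beta cong: if_cong)
    also have "\<dots> \<le> (\<Sum>_\<in>#mset (zip xs ys). 1)"
      by (rule sum_mset_mono) auto
    also have "\<dots> = of_nat (size (M - N))"
      by (simp add: xs[symmetric] len)
    finally show ?thesis .
  qed
  ultimately show ?thesis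
    using matching_cost_le_sum[of 0 P] by simp
qed


section \<open>Comparing powers of distances by counting crossings\<close>

lemma sum_power_le_of_spread:
  fixes a b c d :: real
  assumes "0 \<le> d" "d \<le> b" "d \<le> c" "b \<le> a" "c \<le> a" "b + c \<le> a + d" "n \<ge> 1"
  shows "b ^ n + c ^ n \<le> a ^ n + d ^ n"
  using assms(7)
proof (induction n rule: dec_induct)
  case base
  then show ?case
    using assms by simp
next
  case (step n)
  have "0 \<le> d ^ n * (a + d - b - c)"
    using assms by simp
  also have "\<dots> = d ^ n * (a - b) + d ^ n * (a - c) - d ^ n * (a - d)"
    by (simp add: algebra_simps)
  also have "\<dots> \<le> b ^ n * (a - b) + c ^ n * (a - c) - d ^ n * (a - d)"
    using assms by (intro diff_right_mono add_mono mult_right_mono power_mono) auto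
  finally have "0 \<le> b ^ n * (a - b) + c ^ n * (a - c) - d ^ n * (a - d)" .
  moreover have "a * (b ^ n + c ^ n) \<le> a * (a ^ n + d ^ n)"
    using step.IH assms by (intro mult_left_mono) auto
  ultimately show ?case
    by (simp add: algebra_simps)
qed

text \<open>The \<open>n\<close>-th power of the positive part of \<open>y - x\<close>, that is, the cost of moving upwards from
  \<open>x\<close> to \<open>y\<close>.\<close>

definition gap_power :: "nat \<Rightarrow> real \<Rightarrow> real \<Rightarrow> real" where
  "gap_power n x y = max 0 (y - x) ^ n"

text \<open>A consequence of the convexity of \<open>t \<mapsto> (max 0 t)\<^sup>n\<close>.\<close>

lemma gap_power_submodular:
  assumes "n \<ge> 1" "x \<le> x'" "y \<le> y'"
  shows "gap_power n x' y' + gap_power n x y \<le> gap_power n x y' + gap_power n x' y"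
  unfolding gap_power_def using assms by (intro sum_power_le_of_spread) linarith+

text \<open>On a grid, a function of two variables that vanishes for \<open>y \<le> x\<close> is recovered by summing its
  mixed second differences, up to sign.\<close>

lemma gap_power_decomposition:
  fixes z :: "nat \<Rightarrow> real"
  assumes n: "n \<ge> 1" and z: "mono_on {..m} z" and "i \<le> m" "j \<le> m"
  shows "gap_power n (z i) (z j) =
    (\<Sum>a<m. \<Sum>b<m. (gap_power n (z a) (z (Suc b)) - gap_power n (z (Suc a)) (z (Suc b))
        - gap_power n (z a) (z b) + gap_power n (z (Suc a)) (z b))
      * of_bool (i \<le> a \<and> b < j))"
proof -
  define w where "w a b = gap_power n (z a) (z (Suc b)) - gap_power n (z (Suc a)) (z (Suc b))
        - gap_power n (z a) (z b) + gap_power n (z (Suc a)) (z b)" for a b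
  have zero: "gap_power n x y = 0" if "y \<le> x" for x y
    using that n by (simp add: gap_power_def max_def)
  have inner: "(\<Sum>b<m. w a b * of_bool (i \<le> a \<and> b < j)) =
      of_bool (i \<le> a) * (gap_power n (z a) (z j) - gap_power n (z (Suc a)) (z j)
        - (gap_power n (z a) (z 0) - gap_power n (z (Suc a)) (z 0)))" for a
  proof -
    have "(\<Sum>b<m. w a b * of_bool (i \<le> a \<and> b < j)) = (\<Sum>b<j. w a b * of_bool (i \<le> a))"
      using \<open>j \<le> m\<close> by (intro sum.mono_neutral_cong_right) auto
    also have "\<dots> = of_bool (i \<le> a) * (\<Sum>b<j. (gap_power n (z a) (z (Suc b)) - gap_power n (z (Suc a)) (z (Suc b)))
        - (gap_power n (z a) (z b) - gap_power n (z (Suc a)) (z b)))"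
      by (simp add: w_def sum_distrib_left algebra_simps)
    also have "\<dots> = of_bool (i \<le> a) * (gap_power n (z a) (z j) - gap_power n (z (Suc a)) (z j)
        - (gap_power n (z a) (z 0) - gap_power n (z (Suc a)) (z 0)))"
      by (subst sum_lessThan_telescope) simp
    finally show ?thesis .
  qed
  have z0: "gap_power n (z a) (z 0) = 0" if "a \<le> m" for a
    using that z by (intro zero) (auto intro: mono_onD)
  have "(\<Sum>a<m. \<Sum>b<m. w a b * of_bool (i \<le> a \<and> b < j)) =
      (\<Sum>a\<in>{i..<m}. gap_power n (z a) (z j) - gap_power n (z (Suc a)) (z j))"
    unfolding inner by (intro sum.mono_neutral_cong_right) (auto simp: z0)
  also have "\<dots> = gap_power n (z i) (z j) - gap_power n (z m) (z j)"
    using sum_Suc_diff'[of i m "\<lambda>a. - gap_power n (z a) (z j)"] \<open>i \<le> m\<close> by simp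
  also have "gap_power n (z m) (z j) = 0"
    using \<open>j \<le> m\<close> z by (intro zero) (auto intro: mono_onD)
  finally show ?thesis
    by (simp add: w_def)
qed

text \<open>The number of indices whose pair \<open>(x i, y i)\<close> jumps upwards from at most \<open>s\<close> to above
  \<open>t\<close>.\<close>

definition crossings :: "'i set \<Rightarrow> ('i \<Rightarrow> real) \<Rightarrow> ('i \<Rightarrow> real) \<Rightarrow> real \<Rightarrow> real \<Rightarrow> nat" where
  "crossings I x y s t = card {i \<in> I. x i \<le> s \<and> t < y i}"

text \<open>A power of an upward gap is a nonnegative combination of threshold indicators
  \<open>x \<le> s \<and> t < y\<close> with \<open>s \<le> t\<close>. The weights are the negatives of the mixed second
  differences, and these are nonnegative by submodularity.\<close>

lemma gap_power_as_sum_of_thresholds: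
  assumes "finite Z" "n \<ge> 1"
  obtains m :: nat and z :: "nat \<Rightarrow> real" and w :: "nat \<Rightarrow> nat \<Rightarrow> real"
  where "\<And>a b. a < m \<Longrightarrow> b < m \<Longrightarrow> w a b = 0 \<or> w a b > 0 \<and> z a \<le> z b"
    and "\<And>x y. x \<in> Z \<Longrightarrow> y \<in> Z \<Longrightarrow>
      gap_power n x y = (\<Sum>a<m. \<Sum>b<m. w a b * of_bool (x \<le> z a \<and> z b < y))"
proof -
  define zs where "zs = sorted_list_of_set Z"
  define m where "m = length zs - 1"
  define z where "z k = zs ! k" for k
  have set_zs: "set zs = Z"
    using assms by (simp add: zs_def)
  have sorted: "sorted_wrt (<) zs"
    by (simp add: zs_def)
  have strict: "z a < z b" if "a < b" "b \<le> m" for a b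
    using sorted that by (auto simp: z_def m_def sorted_wrt_iff_nth_less)
  have le_iff: "z a \<le> z b \<longleftrightarrow> a \<le> b" if "a \<le> m" "b \<le> m" for a b
    using strict[of a b] strict[of b a] that by (cases a b rule: linorder_cases) auto
  then have mono: "mono_on {..m} z"
    by (auto intro!: mono_onI)
  define w where "w a b = gap_power n (z a) (z (Suc b)) - gap_power n (z (Suc a)) (z (Suc b))
        - gap_power n (z a) (z b) + gap_power n (z (Suc a)) (z b)" for a b
  show ?thesis
  proof (rule that[of m w z])
    fix a b assume ab: "a < m" "b < m"
    show "w a b = 0 \<or> w a b > 0 \<and> z a \<le> z b"
    proof (cases "a \<le> b")
      case True
      have "w a b \<ge> 0"
        using gap_power_submodular[OF \<open>n \<ge> 1\<close>, of "z a" "z (Suc a)" "z b" "z (Suc b)"] ab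
        by (simp add: w_def le_iff)
      then show ?thesis
        using True ab by (auto simp: le_iff)
    next
      case False
      have "gap_power n (z k) (z l) = 0" if "l \<le> k" "k \<le> m" for k l
        using that le_iff[of l k] \<open>n \<ge> 1\<close> by (simp add: gap_power_def max_def)
      then show ?thesis
        using False ab by (simp add: w_def)
    qed
  next
    fix x y assume xy: "x \<in> Z" "y \<in> Z"
    have ex: "\<exists>i\<le>m. x = z i" if "x \<in> Z" for x
    proof -
      have "x \<in> set zs"
        using that set_zs by simp
      then obtain i where "i < length zs" "zs ! i = x"
        by (meson in_set_conv_nth)
      then show ?thesis
        by (intro exI[of _ i]) (auto simp: z_def m_def)
    qed
    obtain i where i: "i \<le> m" "x = z i"
      using ex xy(1) by blast
    obtain j where j: "j \<le> m" "y = z j"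
      using ex xy(2) by blast
    have *: "(i \<le> a \<and> b < j) = (x \<le> z a \<and> z b < y)" if "a < m" "b < m" for a b
      using le_iff[of i a] le_iff[of j b] i j that by (auto simp: not_le[symmetric])
    have "gap_power n (z i) (z j) = (\<Sum>a<m. \<Sum>b<m. w a b * of_bool (i \<le> a \<and> b < j))"
      using gap_power_decomposition[OF \<open>n \<ge> 1\<close> mono i(1) j(1)] by (simp only: w_def)
    also have "\<dots> = (\<Sum>a<m. \<Sum>b<m. w a b * of_bool (x \<le> z a \<and> z b < y))"
      by (intro sum.cong refl) (simp only: * lessThan_iff)
    finally show "gap_power n x y = (\<Sum>a<m. \<Sum>b<m. w a b * of_bool (x \<le> z a \<and> z b < y))"
      by (simp only: i(2) j(2))
  qed
qed

lemma sum_thresholds: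
  fixes m :: nat and w :: "nat \<Rightarrow> nat \<Rightarrow> real"
  assumes "finite I"
    and "\<And>i. i \<in> I \<Longrightarrow> g i = (\<Sum>a<m. \<Sum>b<m. w a b * of_bool (x i \<le> z a \<and> z b < y i))"
  shows "(\<Sum>i\<in>I. g i) = (\<Sum>a<m. \<Sum>b<m. w a b * real (crossings I x y (z a) (z b)))"
proof -
  have "(\<Sum>i\<in>I. g i) = (\<Sum>i\<in>I. \<Sum>a<m. \<Sum>b<m. w a b * of_bool (x i \<le> z a \<and> z b < y i))"
    using assms(2) by (rule sum.cong[OF refl])
  also have "\<dots> = (\<Sum>a<m. \<Sum>b<m. \<Sum>i\<in>I. w a b * of_bool (x i \<le> z a \<and> z b < y i))"
    by (subst sum.swap, rule sum.cong, simp, rule sum.swap)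
  also have "\<dots> = (\<Sum>a<m. \<Sum>b<m. w a b * (\<Sum>i\<in>I. of_bool (x i \<le> z a \<and> z b < y i)))"
    by (simp add: sum_distrib_left)
  also have "\<dots> = (\<Sum>a<m. \<Sum>b<m. w a b * real (crossings I x y (z a) (z b)))"
    using assms(1) by (simp add: sum_of_bool_eq crossings_def Int_def del: of_bool_conj)
  finally show ?thesis .
qed

lemma sum_gap_power_mono:
  assumes "finite I" "finite J" "n \<ge> 1"
    and le: "\<And>s t. s \<le> t \<Longrightarrow> crossings I x y s t \<le> crossings J u v s t"
  shows "(\<Sum>i\<in>I. gap_power n (x i) (y i)) \<le> (\<Sum>j\<in>J. gap_power n (u j) (v j))"
proof -
  define Z where "Z = x ` I \<union> y ` I \<union> u ` J \<union> v ` J"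
  have "finite Z"
    using assms by (auto simp: Z_def)
  then obtain m :: nat and z w where
    w: "\<And>a b. a < m \<Longrightarrow> b < m \<Longrightarrow> w a b = 0 \<or> w a b > 0 \<and> z a \<le> z b" and
    gap: "\<And>x y. x \<in> Z \<Longrightarrow> y \<in> Z \<Longrightarrow>
      gap_power n x y = (\<Sum>a<m. \<Sum>b<m. w a b * of_bool (x \<le> z a \<and> z b < y))"
    by (rule gap_power_as_sum_of_thresholds[OF _ \<open>n \<ge> 1\<close>]) blast
  have "(\<Sum>i\<in>I. gap_power n (x i) (y i)) = (\<Sum>a<m. \<Sum>b<m. w a b * real (crossings I x y (z a) (z b)))"
    by (intro sum_thresholds gap assms) (auto simp: Z_def)
  also have "\<dots> \<le> (\<Sum>a<m. \<Sum>b<m. w a b * real (crossings J u v (z a) (z b)))"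
  proof (intro sum_mono)
    fix a b assume "a \<in> {..<m}" "b \<in> {..<m}"
    then have "w a b = 0 \<or> w a b > 0 \<and> z a \<le> z b"
      using w by simp
    then show "w a b * real (crossings I x y (z a) (z b)) \<le> w a b * real (crossings J u v (z a) (z b))"
      using le[of "z a" "z b"] by (auto intro: mult_left_mono)
  qed
  also have "\<dots> = (\<Sum>j\<in>J. gap_power n (u j) (v j))"
    by (intro sum_thresholds[symmetric] gap assms) (auto simp: Z_def)
  finally show ?thesis .
qed

lemma sum_power_distance_mono:
  assumes "finite I" "finite J" "n \<ge> 1"
    and "\<And>s t. s \<le> t \<Longrightarrow> crossings I x y s t \<le> crossings J u v s t"
    and "\<And>s t. s \<le> t \<Longrightarrow> crossings I y x s t \<le> crossings J v u s t"
  shows "(\<Sum>i\<in>I. \<bar>x i - y i\<bar> ^ n) \<le> (\<Sum>j\<in>J. \<bar>u j - v j\<bar> ^ n)"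
proof -
  have "\<bar>p - q\<bar> ^ n = gap_power n p q + gap_power n q p" for p q :: real
    using \<open>n \<ge> 1\<close> by (auto simp: gap_power_def max_def abs_if)
  then show ?thesis
    using sum_gap_power_mono[OF assms(1-4)] sum_gap_power_mono[OF assms(1-3,5)]
    by (simp add: sum.distrib)
qed


section \<open>Multisets of weights defined by a set function\<close>

text \<open>The two properties of a matroid rank function that the corresponding nullity shares.\<close>

definition unit_increasing :: "('a set \<Rightarrow> nat) \<Rightarrow> bool" where
  "unit_increasing \<rho> \<longleftrightarrow> \<rho> {} = 0 \<and>
     (\<forall>A e. finite A \<longrightarrow> \<rho> A \<le> \<rho> (insert e A) \<and> \<rho> (insert e A) \<le> Suc (\<rho> A))"

text \<open>Submodularity, in the form that the increment caused by adding \<open>e\<close> does not grow with the set;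
  supermodularity is the reverse inequality.\<close>

definition submodular :: "('a set \<Rightarrow> nat) \<Rightarrow> bool" where
  "submodular \<rho> \<longleftrightarrow>
     (\<forall>A B e. finite B \<longrightarrow> A \<subseteq> B \<longrightarrow> e \<notin> B \<longrightarrow> \<rho> (insert e B) + \<rho> A \<le> \<rho> (insert e A) + \<rho> B)"

definition supermodular :: "('a set \<Rightarrow> nat) \<Rightarrow> bool" where
  "supermodular \<rho> \<longleftrightarrow>
     (\<forall>A B e. finite B \<longrightarrow> A \<subseteq> B \<longrightarrow> e \<notin> B \<longrightarrow> \<rho> (insert e A) + \<rho> B \<le> \<rho> (insert e B) + \<rho> A)"

lemma unit_increasing_Un:
  assumes "unit_increasing \<rho>" "finite A" "finite B"
  shows "\<rho> A \<le> \<rho> (A \<union> B)" "\<rho> (A \<union> B) \<le> \<rho> A + card B"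
proof -
  have "\<rho> A \<le> \<rho> (A \<union> B) \<and> \<rho> (A \<union> B) \<le> \<rho> A + card B"
    using assms(3)
  proof (induction B rule: finite_induct)
    case (insert e B)
    have "\<rho> (A \<union> B) \<le> \<rho> (insert e (A \<union> B)) \<and> \<rho> (insert e (A \<union> B)) \<le> Suc (\<rho> (A \<union> B))"
      using assms(1,2) insert.hyps(1) by (simp add: unit_increasing_def)
    then show ?case
      using insert by auto
  qed simp
  then show "\<rho> A \<le> \<rho> (A \<union> B)" "\<rho> (A \<union> B) \<le> \<rho> A + card B"
    by auto
qed

lemma unit_increasing_mono: "unit_increasing \<rho> \<Longrightarrow> A \<subseteq> B \<Longrightarrow> finite B \<Longrightarrow> \<rho> A \<le> \<rho> B"
  using unit_increasing_Un(1)[of \<rho> A B] finite_subset[of A B] by (simp add: Un_absorb1)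

lemma unit_increasing_le_Diff:
  assumes "unit_increasing \<rho>" "finite A" "finite B"
  shows "\<rho> A \<le> \<rho> B + card (A - B)"
proof -
  have "\<rho> A \<le> \<rho> (B \<union> (A - B))"
    using assms by (intro unit_increasing_mono) auto
  also have "\<dots> \<le> \<rho> B + card (A - B)"
    using assms by (intro unit_increasing_Un) auto
  finally show ?thesis .
qed

text \<open>The multiset \<open>M\<close> of reals that counts the increments of \<open>\<rho>\<close> along the sublevel sets of
  \<open>w\<close>: an initial segment of the real line contains as many elements of \<open>M\<close> as the value of
  \<open>\<rho>\<close> on its preimage. Initial segments are given by antitone predicates, so that strict and
  non-strict thresholds and the whole line are covered at once.\<close>

definition level_multiset :: "('a set \<Rightarrow> nat) \<Rightarrow> 'a set \<Rightarrow> ('a \<Rightarrow> real) \<Rightarrow> real multiset \<Rightarrow> bool" where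
  "level_multiset \<rho> S w M \<longleftrightarrow>
     (\<forall>Q. antimono Q \<longrightarrow> size (filter_mset Q M) = \<rho> {\<sigma> \<in> S. Q (w \<sigma>)})"

lemma antimono_thresholds: "antimono (\<lambda>x. x \<le> (t::real))" "antimono (\<lambda>x. x < (t::real))" "antimono (\<lambda>x::real. True)"
  by (auto simp: monotone_def)

lemma level_multiset_size: "level_multiset \<rho> S w M \<Longrightarrow> size M = \<rho> S"
  unfolding level_multiset_def using antimono_thresholds(3) by fastforce

lemma level_multiset_le: "level_multiset \<rho> S w M \<Longrightarrow> size (filter_mset (\<lambda>x. x \<le> t) M) = \<rho> {\<sigma> \<in> S. w \<sigma> \<le> t}"
  unfolding level_multiset_def using antimono_thresholds(1)[of t] by simp

lemma level_multiset_count: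
  assumes "level_multiset \<rho> S w M"
  shows "count M x + \<rho> {\<sigma> \<in> S. w \<sigma> < x} = \<rho> {\<sigma> \<in> S. w \<sigma> \<le> x}"
proof -
  have "filter_mset (\<lambda>y. y \<le> x) M = replicate_mset (count M x) x + filter_mset (\<lambda>y. y < x) M"
    by (auto simp: multiset_eq_iff)
  then have "size (filter_mset (\<lambda>y. y \<le> x) M) = count M x + size (filter_mset (\<lambda>y. y < x) M)"
    by simp
  then show ?thesis
    using assms antimono_thresholds(1,2)[of x] by (simp add: level_multiset_def)
qed

text \<open>The elements of the list at which \<open>\<rho>\<close> of the initial segment goes up by one. If \<open>\<rho>\<close> is a
  matroid rank function, this is the basis found by the greedy algorithm.\<close>

definition jumps :: "('a set \<Rightarrow> nat) \<Rightarrow> 'a list \<Rightarrow> 'a set" where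
  "jumps \<rho> L = {L ! i | i. i < length L \<and> \<rho> (set (take (Suc i) L)) = Suc (\<rho> (set (take i L)))}"

lemma level_multiset_jumps:
  assumes \<rho>: "unit_increasing \<rho>" and L: "distinct L" "set L = S"
    and sorted: "\<And>i j. i < j \<Longrightarrow> j < length L \<Longrightarrow> w (L ! i) \<le> w (L ! j)"
  shows "level_multiset \<rho> S w (image_mset w (mset_set (jumps \<rho> L)))"
  unfolding level_multiset_def
proof (intro allI impI)
  fix Q :: "real \<Rightarrow> bool" assume Q: "antimono Q"
  define J where "J n = {i. i < n \<and> \<rho> (set (take (Suc i) L)) = Suc (\<rho> (set (take i L)))}" for n
  have card_J: "card (J n) = \<rho> (set (take n L))" if "n \<le> length L" for n
    using that
  proof (induction n)
    case 0
    then show ?case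
      using \<rho> by (simp add: J_def unit_increasing_def)
  next
    case (Suc n)
    have "\<rho> (set (take n L)) \<le> \<rho> (set (take (Suc n) L)) \<and> \<rho> (set (take (Suc n) L)) \<le> Suc (\<rho> (set (take n L)))"
      using \<rho> Suc.prems by (simp add: take_Suc_conv_app_nth unit_increasing_def)
    moreover have "J (Suc n) = (if \<rho> (set (take (Suc n) L)) = Suc (\<rho> (set (take n L))) then insert n (J n) else J n)"
      by (auto simp: J_def less_Suc_eq)
    moreover have "finite (J n)" "n \<notin> J n"
      by (auto simp: J_def)
    ultimately show ?case
      using Suc by auto
  qed
  define n where "n = length (takeWhile (\<lambda>\<sigma>. Q (w \<sigma>)) L)"
  have n_le: "n \<le> length L"
    by (simp add: n_def length_takeWhile_le)
  have n_iff: "Q (w (L ! i)) \<longleftrightarrow> i < n" if "i < length L" for i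
  proof
    assume "i < n"
    then show "Q (w (L ! i))"
      using takeWhile_nth[of i "\<lambda>\<sigma>. Q (w \<sigma>)" L] nth_mem[of i "takeWhile (\<lambda>\<sigma>. Q (w \<sigma>)) L"]
      by (auto simp: n_def dest: set_takeWhileD)
  next
    assume i: "Q (w (L ! i))"
    show "i < n"
    proof (rule ccontr)
      assume "\<not> i < n"
      then have "\<not> Q (w (L ! n))"
        using that by (auto simp: n_def intro!: nth_length_takeWhile)
      moreover have "w (L ! n) \<le> w (L ! i)"
        using sorted[of n i] \<open>\<not> i < n\<close> that by (cases "n = i") auto
      ultimately show False
        using i Q by (auto simp: monotone_def)
    qed
  qed
  have "{\<sigma> \<in> S. Q (w \<sigma>)} = set (take n L)"
  proof (intro set_eqI iffI)
    fix \<sigma> assume "\<sigma> \<in> {\<sigma> \<in> S. Q (w \<sigma>)}"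
    then obtain i where i: "i < length L" "L ! i = \<sigma>" "Q (w (L ! i))"
      using L(2) by (metis (no_types, lifting) in_set_conv_nth mem_Collect_eq)
    then show "\<sigma> \<in> set (take n L)"
      using n_iff[OF i(1)] by (auto simp: in_set_conv_nth)
  next
    fix \<sigma> assume "\<sigma> \<in> set (take n L)"
    then obtain i where i: "i < n" "i < length L" "\<sigma> = L ! i"
      by (auto simp: in_set_conv_nth)
    then show "\<sigma> \<in> {\<sigma> \<in> S. Q (w \<sigma>)}"
      using n_iff[OF i(2)] L(2) nth_mem[OF i(2)] by simp
  qed
  moreover have "{\<sigma> \<in> jumps \<rho> L. Q (w \<sigma>)} = (!) L ` J n"
  proof (intro set_eqI iffI)
    fix \<sigma> assume "\<sigma> \<in> {\<sigma> \<in> jumps \<rho> L. Q (w \<sigma>)}"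
    then obtain i where i: "i < length L" "\<sigma> = L ! i" "Q (w (L ! i))"
      "\<rho> (set (take (Suc i) L)) = Suc (\<rho> (set (take i L)))"
      unfolding jumps_def by blast
    then have "i \<in> J n"
      using n_iff[OF i(1)] by (simp add: J_def)
    then show "\<sigma> \<in> (!) L ` J n"
      using i(2) by blast
  next
    fix \<sigma> assume "\<sigma> \<in> (!) L ` J n"
    then obtain i where i: "\<sigma> = L ! i" "i < n"
      "\<rho> (set (take (Suc i) L)) = Suc (\<rho> (set (take i L)))"
      by (auto simp: J_def)
    then have "i < length L"
      using n_le by simp
    with i show "\<sigma> \<in> {\<sigma> \<in> jumps \<rho> L. Q (w \<sigma>)}"
      using n_iff[of i] by (auto simp: jumps_def)
  qed
  moreover have "inj_on ((!) L) (J n)"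
    using L(1) n_le by (auto simp: inj_on_def J_def nth_eq_iff_index_eq)
  moreover have "finite (jumps \<rho> L)"
    by (simp add: jumps_def)
  ultimately show "size (filter_mset Q (image_mset w (mset_set (jumps \<rho> L)))) = \<rho> {\<sigma> \<in> S. Q (w \<sigma>)}"
    using card_J[OF n_le] by (simp add: filter_mset_image_mset filter_mset_mset_set card_image)
qed

lemma ex_level_multiset:
  assumes "unit_increasing \<rho>" "finite S"
  shows "\<exists>M. level_multiset \<rho> S w M"
proof -
  obtain L0 where L0: "set L0 = S" "distinct L0"
    using finite_distinct_list[OF assms(2)] by blast
  have "level_multiset \<rho> S w (image_mset w (mset_set (jumps \<rho> (sort_key w L0))))"
  proof (rule level_multiset_jumps[OF assms(1)])
    fix i j assume "i < j" "j < length (sort_key w L0)"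
    then show "w (sort_key w L0 ! i) \<le> w (sort_key w L0 ! j)"
      using sorted_sort_key[of w L0] sorted_nth_mono[of "map w (sort_key w L0)" i j] by simp
  qed (use L0 in auto)
  then show ?thesis
    by blast
qed

lemma size_le_1_of_count_le:
  assumes "\<And>x. count M x \<le> count N x + of_bool (x = a)"
  shows "size (M - N) \<le> 1"
proof -
  have "M - N \<subseteq># {#a#}"
  proof (rule mset_subset_eqI)
    fix x show "count (M - N) x \<le> count {#a#} x"
      using assms[of x] by (cases "x = a") auto
  qed
  then show ?thesis
    using size_mset_mono by fastforce
qed

lemma size_Diff_triangle:
  fixes M N P :: "'a multiset"
  shows "size (M - P) \<le> size (M - N) + size (N - P)"
proof -
  have "M - P \<subseteq># (M - N) + (N - P)"
    by (auto simp: subseteq_mset_def)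
  then show ?thesis
    using size_mset_mono by fastforce
qed

text \<open>For a matroid rank function: raising the weight of \<open>e\<close> replaces at most one value in the
  multiset of weights of the greedy basis, and the value that is lost is \<open>f e\<close>. For a nullity it is
  the value gained that is known, namely \<open>f' e\<close>, hence the detour through \<open>N - M\<close>.\<close>

lemma level_multiset_raise_one:
  assumes \<rho>: "unit_increasing \<rho>" "submodular \<rho> \<or> supermodular \<rho>" and S: "finite S" "e \<in> S"
    and M: "level_multiset \<rho> S f M" and N: "level_multiset \<rho> S f' N"
    and f': "f e < f' e" "\<And>\<sigma>. \<sigma> \<in> S \<Longrightarrow> \<sigma> \<noteq> e \<Longrightarrow> f' \<sigma> = f \<sigma>"
  shows "size (M - N) \<le> 1"
proof -
  define A where "A x = {\<sigma> \<in> S - {e}. f \<sigma> < x}" for x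
  define B where "B x = {\<sigma> \<in> S - {e}. f \<sigma> \<le> x}" for x
  have fin: "finite (A x)" "finite (B x)" and sub: "A x \<subseteq> B x" and e: "e \<notin> A x" "e \<notin> B x" for x
    using S by (auto simp: A_def B_def)
  have f'_less: "{\<sigma> \<in> S. f' \<sigma> < x} = {\<sigma> \<in> S. if \<sigma> = e then f' e < x else f \<sigma> < x}"
    and f'_le: "{\<sigma> \<in> S. f' \<sigma> \<le> x} = {\<sigma> \<in> S. if \<sigma> = e then f' e \<le> x else f \<sigma> \<le> x}" for x
    by (intro Collect_cong conj_cong refl; simp add: f'(2))+
  have sets: "{\<sigma> \<in> S. f \<sigma> < x} = (if f e < x then insert e (A x) else A x)"
    "{\<sigma> \<in> S. f \<sigma> \<le> x} = (if f e \<le> x then insert e (B x) else B x)"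
    "{\<sigma> \<in> S. f' \<sigma> < x} = (if f' e < x then insert e (A x) else A x)"
    "{\<sigma> \<in> S. f' \<sigma> \<le> x} = (if f' e \<le> x then insert e (B x) else B x)" for x
    unfolding f'_less f'_le using S by (auto simp: A_def B_def)
  have unit: "\<rho> (A x) \<le> \<rho> (insert e (A x))" "\<rho> (insert e (A x)) \<le> Suc (\<rho> (A x))"
    "\<rho> (B x) \<le> \<rho> (insert e (B x))" "\<rho> (insert e (B x)) \<le> Suc (\<rho> (B x))" for x
    using \<rho>(1) fin[of x] by (simp_all add: unit_increasing_def)
  have counts: "count M x + \<rho> (if f e < x then insert e (A x) else A x) = \<rho> (if f e \<le> x then insert e (B x) else B x)"
    "count N x + \<rho> (if f' e < x then insert e (A x) else A x) = \<rho> (if f' e \<le> x then insert e (B x) else B x)" for x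
    using level_multiset_count[OF M, of x] level_multiset_count[OF N, of x] unfolding sets by auto
  from \<rho>(2) show ?thesis
  proof
    assume "submodular \<rho>"
    then have *: "\<rho> (insert e (B x)) + \<rho> (A x) \<le> \<rho> (insert e (A x)) + \<rho> (B x)" for x
      using fin[of x] sub[of x] e[of x] by (simp add: submodular_def)
    \<comment> \<open>Strictly between the two weights, \<open>M\<close> sees the increments with \<open>e\<close> present and \<open>N\<close> those
      without \<open>e\<close>; by submodularity the former are not larger.\<close>
    have "count M x \<le> count N x + of_bool (x = f e)" for x
      using counts[of x] unit[of x] *[of x] f'(1)
      by (cases x "f e" rule: linorder_cases; cases x "f' e" rule: linorder_cases) auto
    then show ?thesis
      by (rule size_le_1_of_count_le)
  next
    assume "supermodular \<rho>"
    then have *: "\<rho> (insert e (A x)) + \<rho> (B x) \<le> \<rho> (insert e (B x)) + \<rho> (A x)" for x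
      using fin[of x] sub[of x] e[of x] by (simp add: supermodular_def)
    have "count N x \<le> count M x + of_bool (x = f' e)" for x
      using counts[of x] unit[of x] *[of x] f'(1)
      by (cases x "f e" rule: linorder_cases; cases x "f' e" rule: linorder_cases) auto
    then have "size (N - M) \<le> 1"
      by (rule size_le_1_of_count_le)
    then show ?thesis
      using size_Diff_commute[of M N] level_multiset_size[OF M] level_multiset_size[OF N] by simp
  qed
qed

lemma level_multiset_change_one:
  assumes \<rho>: "unit_increasing \<rho>" "submodular \<rho> \<or> supermodular \<rho>" and S: "finite S" "e \<in> S"
    and M: "level_multiset \<rho> S f M" and N: "level_multiset \<rho> S f' N"
    and f': "f' e \<noteq> f e" "\<And>\<sigma>. \<sigma> \<in> S \<Longrightarrow> \<sigma> \<noteq> e \<Longrightarrow> f' \<sigma> = f \<sigma>"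
  shows "size (M - N) \<le> 1"
proof (cases "f e < f' e")
  case True
  then show ?thesis
    using assms level_multiset_raise_one by metis
next
  case False
  then have "size (N - M) \<le> 1"
    using f' by (intro level_multiset_raise_one[OF \<rho> S N M]) auto
  then show ?thesis
    using size_Diff_commute[of M N] level_multiset_size[OF M] level_multiset_size[OF N] by simp
qed

lemma level_multiset_cong:
  assumes "\<And>\<sigma>. \<sigma> \<in> S \<Longrightarrow> f \<sigma> = f' \<sigma>"
  shows "level_multiset \<rho> S f M \<longleftrightarrow> level_multiset \<rho> S f' M"
proof -
  have "{\<sigma> \<in> S. Q (f \<sigma>)} = {\<sigma> \<in> S. Q (f' \<sigma>)}" for Q
    using assms by auto
  then show ?thesis
    by (simp add: level_multiset_def)
qed

lemma level_multiset_unique: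
  assumes "level_multiset \<rho> S w M" "level_multiset \<rho> S w N"
  shows "M = N"
proof (rule multiset_eqI)
  fix x show "count M x = count N x"
    using level_multiset_count[OF assms(1), of x] level_multiset_count[OF assms(2), of x] by linarith
qed

text \<open>The weights are changed one element at a time, which is admissible because the cost counted
  here satisfies the triangle inequality.\<close>

lemma level_multiset_Diff_le_changes:
  assumes \<rho>: "unit_increasing \<rho>" "submodular \<rho> \<or> supermodular \<rho>" and S: "finite S"
    and M: "level_multiset \<rho> S f M" and N: "level_multiset \<rho> S f' N"
  shows "size (M - N) \<le> card {\<sigma> \<in> S. f \<sigma> \<noteq> f' \<sigma>}"
proof -
  have "size (M - N) \<le> card T"
    if "finite T" "level_multiset \<rho> S f M" "T = {\<sigma> \<in> S. f \<sigma> \<noteq> f' \<sigma>}" for T f M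
    using that
  proof (induction T arbitrary: f M rule: finite_induct)
    case empty
    have "f \<sigma> = f' \<sigma>" if "\<sigma> \<in> S" for \<sigma>
      using empty.prems(2) that by blast
    then have "level_multiset \<rho> S f M \<longleftrightarrow> level_multiset \<rho> S f' M"
      by (rule level_multiset_cong)
    then have "M = N"
      using level_multiset_unique[OF _ N, of M] empty.prems(1) by simp
    then show ?case
      by simp
  next
    case (insert e T)
    define g where "g = f(e := f' e)"
    obtain P where P: "level_multiset \<rho> S g P"
      using ex_level_multiset[OF \<rho>(1) S] by blast
    have e: "e \<in> S" "f e \<noteq> f' e"
      using insert.prems(2) by auto
    have "T = {\<sigma> \<in> S. g \<sigma> \<noteq> f' \<sigma>}"
      using insert.hyps(2) insert.prems(2) by (auto simp: g_def)
    then have "size (P - N) \<le> card T"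
      by (rule insert.IH[OF P])
    moreover have "size (M - P) \<le> 1"
      by (rule level_multiset_change_one[OF \<rho> S e(1) insert.prems(1) P]) (use e(2) in \<open>auto simp: g_def\<close>)
    ultimately show ?case
      using size_Diff_triangle[of M N P] insert.hyps by simp
  qed
  then show ?thesis
    using M S by simp
qed

lemma filter_sorted_iff_less:
  fixes xs :: "real list"
  assumes "sorted xs" "i < length xs" "antimono Q"
  shows "Q (xs ! i) \<longleftrightarrow> i < size (filter_mset Q (mset xs))"
proof -
  have eq: "{j. j < length xs \<and> Q (xs ! j)} = {..<length (takeWhile Q xs)}"
  proof (intro set_eqI iffI)
    fix j assume j: "j \<in> {j. j < length xs \<and> Q (xs ! j)}"
    show "j \<in> {..<length (takeWhile Q xs)}"
    proof (rule ccontr)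
      assume *: "j \<notin> {..<length (takeWhile Q xs)}"
      then have "\<not> Q (xs ! length (takeWhile Q xs))"
        using j by (intro nth_length_takeWhile) auto
      moreover have "xs ! length (takeWhile Q xs) \<le> xs ! j"
        using * j by (intro sorted_nth_mono assms(1)) auto
      ultimately show False
        using j assms(3) by (auto simp: monotone_def)
    qed
  next
    fix j assume "j \<in> {..<length (takeWhile Q xs)}"
    then show "j \<in> {j. j < length xs \<and> Q (xs ! j)}"
      using takeWhile_nth[of j Q xs] nth_mem[of j "takeWhile Q xs"] length_takeWhile_le[of Q xs]
      by (auto dest: set_takeWhileD)
  qed
  then have "size (filter_mset Q (mset xs)) = length (takeWhile Q xs)"
    by (simp add: length_filter_conv_card flip: mset_filter)
  moreover have "i \<in> {j. j < length xs \<and> Q (xs ! j)} \<longleftrightarrow> i \<in> {..<length (takeWhile Q xs)}"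
    by (simp only: eq)
  ultimately show ?thesis
    using assms(2) by simp
qed

lemma crossings_sorted:
  assumes xs: "sorted xs" and ys: "sorted ys" and len: "length xs = length ys"
  shows "crossings {..<length xs} ((!) xs) ((!) ys) s t =
    size (filter_mset (\<lambda>x. x \<le> s) (mset xs)) - size (filter_mset (\<lambda>y. y \<le> t) (mset ys))"
proof -
  define a where "a = size (filter_mset (\<lambda>x. x \<le> s) (mset xs))"
  define b where "b = size (filter_mset (\<lambda>y. y \<le> t) (mset ys))"
  have "a \<le> length xs"
    using size_filter_mset_lesseq[of "\<lambda>x. x \<le> s" "mset xs"] by (simp add: a_def)
  moreover have "xs ! i \<le> s \<longleftrightarrow> i < a" "t < ys ! i \<longleftrightarrow> b \<le> i" if "i < length xs" for i
    using filter_sorted_iff_less[OF xs that antimono_thresholds(1)[of s]]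
      filter_sorted_iff_less[OF ys _ antimono_thresholds(1)[of t], of i] that len
    by (auto simp: a_def b_def not_le)
  ultimately have "{i \<in> {..<length xs}. xs ! i \<le> s \<and> t < ys ! i} = {b..<a}"
    by auto
  then show ?thesis
    by (simp add: crossings_def a_def b_def)
qed

text \<open>If \<open>k > 0\<close> sorted pairs jump from at most \<open>s\<close> to above \<open>t\<close>, then
  \<open>\<rho> {f \<le> s} \<ge> \<rho> {f' \<le> t} + k\<close>, so at least \<open>k\<close> elements of \<open>{f \<le> s}\<close> lie outside
  \<open>{f' \<le> t}\<close>.\<close>

lemma crossings_level_multisets:
  assumes \<rho>: "unit_increasing \<rho>" and S: "finite S"
    and M: "level_multiset \<rho> S f M" and N: "level_multiset \<rho> S f' N"
  defines "xs \<equiv> sorted_list_of_multiset M" and "ys \<equiv> sorted_list_of_multiset N"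
  shows "crossings {..<length xs} ((!) xs) ((!) ys) s t \<le> crossings S f f' s t"
proof -
  have "length xs = length ys"
    using level_multiset_size[OF M] level_multiset_size[OF N]
    by (simp add: xs_def ys_def flip: size_mset)
  then have "crossings {..<length xs} ((!) xs) ((!) ys) s t = \<rho> {\<sigma> \<in> S. f \<sigma> \<le> s} - \<rho> {\<sigma> \<in> S. f' \<sigma> \<le> t}"
    by (subst crossings_sorted)
      (simp_all add: xs_def ys_def level_multiset_le[OF M] level_multiset_le[OF N])
  also have "\<dots> \<le> card ({\<sigma> \<in> S. f \<sigma> \<le> s} - {\<sigma> \<in> S. f' \<sigma> \<le> t})"
    using unit_increasing_le_Diff[OF \<rho>, of "{\<sigma> \<in> S. f \<sigma> \<le> s}" "{\<sigma> \<in> S. f' \<sigma> \<le> t}"] S by simp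
  also have "{\<sigma> \<in> S. f \<sigma> \<le> s} - {\<sigma> \<in> S. f' \<sigma> \<le> t} = {\<sigma> \<in> S. f \<sigma> \<le> s \<and> t < f' \<sigma>}"
    by auto
  finally show ?thesis
    by (simp add: crossings_def)
qed

text \<open>Domination of crossings also bounds the largest gap: were all gaps on the right at most
  \<open>\<epsilon> < y i - x i\<close>, then only the left side would cross from \<open>x i\<close> to above \<open>x i + \<epsilon>\<close>.\<close>

lemma ex_larger_gap:
  assumes "finite I" "finite J"
    and le: "\<And>s t. crossings I x y s t \<le> crossings J u v s t"
    and i: "i \<in> I" "x i < y i"
  shows "\<exists>j\<in>J. y i - x i \<le> v j - u j"
proof (rule ccontr)
  assume *: "\<not> ?thesis"
  define \<epsilon> where "\<epsilon> = Max (insert 0 ((\<lambda>j. v j - u j) ` J))"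
  have "\<epsilon> < y i - x i"
    using * i(2) assms(2) by (auto simp: \<epsilon>_def not_le)
  then have "i \<in> {i' \<in> I. x i' \<le> x i \<and> x i + \<epsilon> < y i'}"
    using i(1) by simp
  then have "crossings I x y (x i) (x i + \<epsilon>) > 0"
    unfolding crossings_def using assms(1) by (auto simp: card_gt_0_iff)
  moreover have "v j - u j \<le> \<epsilon>" if "j \<in> J" for j
    unfolding \<epsilon>_def using assms(2) that by (intro Max_ge) auto
  then have "{j \<in> J. u j \<le> x i \<and> x i + \<epsilon> < v j} = {}"
    by fastforce
  then have "crossings J u v (x i) (x i + \<epsilon>) = 0"
    unfolding crossings_def by (simp only: card.empty)
  ultimately show False
    using le[of "x i" "x i + \<epsilon>"] by simp
qed

text \<open>For positive \<open>p\<close> the matching of the sorted lists does it. For \<open>p = 0\<close> that matching can be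
  too expensive, and the common elements are matched instead.\<close>

lemma matching_cost_level_multisets:
  assumes \<rho>: "unit_increasing \<rho>" "submodular \<rho> \<or> supermodular \<rho>" and S: "finite S"
    and M: "level_multiset \<rho> S f M" and N: "level_multiset \<rho> S f' N"
  shows "matching_cost p M N \<le> power_sum p S (\<lambda>\<sigma>. f \<sigma> - f' \<sigma>)"
proof -
  define xs where "xs = sorted_list_of_multiset M"
  define ys where "ys = sorted_list_of_multiset N"
  have sizes: "size M = size N"
    using level_multiset_size[OF M] level_multiset_size[OF N] by simp
  then have len: "length ys = length xs"
    by (simp add: xs_def ys_def flip: size_mset)
  define P where "P = mset (zip xs ys)"
  have P: "image_mset fst P = M" "image_mset snd P = N"
    by (simp_all add: P_def len mset_map[symmetric] del: mset_map) (simp_all add: xs_def ys_def)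
  have P_index: "P = image_mset (\<lambda>i. (xs ! i, ys ! i)) (mset_set {..<length xs})"
  proof -
    have "zip xs ys = map (\<lambda>i. (xs ! i, ys ! i)) [0..<length xs]"
      by (rule nth_equalityI) (simp_all add: len)
    then show ?thesis
      by (simp add: P_def atLeast0LessThan)
  qed
  have cross: "crossings {..<length xs} ((!) xs) ((!) ys) s t \<le> crossings S f f' s t"
    "crossings {..<length xs} ((!) ys) ((!) xs) s t \<le> crossings S f' f s t" for s t
    using crossings_level_multisets[OF \<rho>(1) S M N, of s t] crossings_level_multisets[OF \<rho>(1) S N M, of s t]
    by (simp_all add: xs_def[symmetric] ys_def[symmetric] len)
  consider (zero) "p = enat 0" | (pos) n where "p = enat n" "n \<ge> 1" | (inf) "p = \<infinity>"
    by (cases p) (auto simp: Suc_le_eq)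
  then show ?thesis
  proof cases
    case zero
    have "matching_cost p M N \<le> of_nat (size (M - N))"
      unfolding zero by (rule matching_cost_0_le[OF sizes])
    also have "\<dots> \<le> of_nat (card {\<sigma> \<in> S. f \<sigma> \<noteq> f' \<sigma>})"
      by (intro of_nat_mono level_multiset_Diff_le_changes[OF \<rho> S M N])
    also have "\<dots> = (\<Sum>\<sigma>\<in>{\<sigma> \<in> S. f \<sigma> \<noteq> f' \<sigma>}. 1)"
      by simp
    also have "\<dots> = (\<Sum>\<sigma>\<in>S. if f \<sigma> - f' \<sigma> = 0 then 0 else ennreal (\<bar>f \<sigma> - f' \<sigma>\<bar> ^ 0))"
      using S by (intro sum.mono_neutral_cong_left) auto
    also have "\<dots> = power_sum p S (\<lambda>\<sigma>. f \<sigma> - f' \<sigma>)"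
      by (simp only: power_sum_def zero enat.case)
    finally show ?thesis .
  next
    case pos
    have drop_if: "(if x = 0 then 0 else ennreal (\<bar>x\<bar> ^ n)) = ennreal (\<bar>x\<bar> ^ n)" for x :: real
      using pos(2) by simp
    have "matching_cost p M N \<le> (\<Sum>(x, y)\<in>#P. if x - y = 0 then 0 else ennreal (\<bar>x - y\<bar> ^ n))"
      using matching_cost_le_sum[of n P] by (simp add: P pos(1))
    also have "\<dots> = (\<Sum>i<length xs. ennreal (\<bar>xs ! i - ys ! i\<bar> ^ n))"
      unfolding drop_if P_index by (simp add: sum_unfold_sum_mset image_mset.compositionality comp_def)
    also have "\<dots> = ennreal (\<Sum>i<length xs. \<bar>xs ! i - ys ! i\<bar> ^ n)"
      by (rule sum_ennreal) simp
    also have "\<dots> \<le> ennreal (\<Sum>\<sigma>\<in>S. \<bar>f \<sigma> - f' \<sigma>\<bar> ^ n)"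
      by (intro ennreal_leI sum_power_distance_mono cross S pos(2)) simp
    also have "\<dots> = (\<Sum>\<sigma>\<in>S. ennreal (\<bar>f \<sigma> - f' \<sigma>\<bar> ^ n))"
      by (rule sum_ennreal[symmetric]) simp
    also have "\<dots> = power_sum p S (\<lambda>\<sigma>. f \<sigma> - f' \<sigma>)"
      by (simp only: power_sum_def pos(1) enat.case drop_if)
    finally show ?thesis .
  next
    case inf
    have "ennreal \<bar>x - y\<bar> \<le> power_sum p S (\<lambda>\<sigma>. f \<sigma> - f' \<sigma>)" if xy: "(x, y) \<in># P" for x y
    proof (cases "x = y")
      case False
      obtain i where i: "i \<in> {..<length xs}" "x = xs ! i" "y = ys ! i"
        using xy by (auto simp: P_index)
      have "\<exists>\<sigma>\<in>S. \<bar>x - y\<bar> \<le> \<bar>f \<sigma> - f' \<sigma>\<bar>"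
      proof (cases "x < y")
        case True
        then obtain \<sigma> where "\<sigma> \<in> S" "y - x \<le> f' \<sigma> - f \<sigma>"
          using ex_larger_gap[OF finite_lessThan S cross(1) i(1)] i by auto
        then show ?thesis
          using True by (intro bexI[of _ \<sigma>]) auto
      next
        case False
        with \<open>x \<noteq> y\<close> obtain \<sigma> where "\<sigma> \<in> S" "x - y \<le> f \<sigma> - f' \<sigma>"
          using ex_larger_gap[OF finite_lessThan S cross(2) i(1)] i by auto
        then show ?thesis
          using False by (intro bexI[of _ \<sigma>]) auto
      qed
      then show ?thesis
        by (auto simp: power_sum_def inf intro!: SUP_upper2 ennreal_leI)
    qed simp
    then show ?thesis
      using matching_cost_infinity_le[of P] by (simp add: P inf)
  qed
qed


section \<open>Betti numbers and the boundary matroid\<close>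

lemma dim_insert_finite_span:
  assumes "finite F" "V \<subseteq> chain.span F"
  shows "chain.dim (insert x V) = (if x \<in> chain.span V then chain.dim V else Suc (chain.dim V))"
proof (cases "x \<in> chain.span V")
  case True
  have "chain.span (insert x V) = chain.span V"
    using True by (rule chain.span_redundant)
  then show ?thesis
    using True by (metis chain.dim_span)
next
  case False
  obtain B where B: "B \<subseteq> V" "chain.independent B" "V \<subseteq> chain.span B" "card B = chain.dim V"
    by (rule chain.basis_exists)
  have "finite B"
    using chain.independent_span_bound[OF assms(1) B(2)] B(1) assms(2) by blast
  have span: "chain.span B = chain.span V"
    unfolding chain.span_eq using B(1,3) chain.span_superset[of V] by blast
  have "x \<notin> B"
    using False span chain.span_base by blast
  have "chain.dim (insert x V) = Suc (card B)"
  proof (rule chain.dim_unique)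
    show "insert x B \<subseteq> insert x V"
      using B(1) by blast
    show "insert x V \<subseteq> chain.span (insert x B)"
      using B(3) chain.span_mono[of B "insert x B"] chain.span_base[of x "insert x B"] by blast
    show "chain.independent (insert x B)"
      using False span B(2) by (simp add: chain.independent_insertI)
    show "card (insert x B) = Suc (card B)"
      using \<open>finite B\<close> \<open>x \<notin> B\<close> by simp
  qed
  then show ?thesis
    using False B(4) by simp
qed

text \<open>The rank and the nullity of a set of faces in the linear matroid given by the boundaries of the
  faces.\<close>

definition boundary_rank :: "'k::field itself \<Rightarrow> 'v set set \<Rightarrow> nat" where
  "boundary_rank _ A = chain.dim (face_boundary ` A :: ('v set \<Rightarrow> 'k) set)"

definition boundary_nullity :: "'k::field itself \<Rightarrow> 'v set set \<Rightarrow> nat" where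
  "boundary_nullity k A = card A - boundary_rank k A"

text \<open>The chain that consists of a single face with coefficient \<open>1\<close>.\<close>

definition elementary_chain :: "'v set \<Rightarrow> ('v set \<Rightarrow> 'k::field)" where
  "elementary_chain \<sigma> = (\<lambda>\<tau>. if \<tau> = \<sigma> then 1 else 0)"

lemma boundary_rank_insert:
  assumes "finite A"
  shows "boundary_rank TYPE('k::field) (insert \<sigma> A) =
    (if (face_boundary \<sigma> :: 'v set \<Rightarrow> 'k) \<in> chain.span (face_boundary ` A)
     then boundary_rank TYPE('k) A else Suc (boundary_rank TYPE('k) A))"
  unfolding boundary_rank_def image_insert
  by (rule dim_insert_finite_span[OF finite_imageI[OF assms] chain.span_superset])

lemma boundary_rank_empty: "boundary_rank k {} = 0"
  using chain.dim_eq_card_independent[OF chain.independent_empty] by (simp add: boundary_rank_def)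

lemma boundary_rank_le_card: "finite A \<Longrightarrow> boundary_rank TYPE('k::field) A \<le> card A"
  by (induction A rule: finite_induct)
    (auto simp: boundary_rank_empty boundary_rank_insert)

lemma boundary_nullity_insert:
  assumes "finite A" "\<sigma> \<notin> A"
  shows "boundary_nullity TYPE('k::field) (insert \<sigma> A) =
    (if (face_boundary \<sigma> :: 'v set \<Rightarrow> 'k) \<in> chain.span (face_boundary ` A)
     then Suc (boundary_nullity TYPE('k) A) else boundary_nullity TYPE('k) A)"
  using assms boundary_rank_le_card[OF assms(1), where 'k='k]
  by (auto simp: boundary_nullity_def boundary_rank_insert)

lemma boundary_nullity_empty: "boundary_nullity k {} = 0"
  by (simp add: boundary_nullity_def)

lemma subspace_chains: "chain.subspace (chains K j)"
  by (rule chain.subspaceI) (auto simp: chains_def chain_scale_def, force)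

lemma boundary_add: "boundary K (c + c') = boundary K c + boundary K c'"
  by (auto simp: boundary_def fun_eq_iff algebra_simps sum.distrib)

lemma boundary_scale: "boundary K (chain_scale a c) = chain_scale a (boundary K c)"
  by (auto simp: boundary_def chain_scale_def fun_eq_iff sum_distrib_left mult.assoc)

lemma boundary_zero: "boundary K 0 = 0"
  by (auto simp: boundary_def fun_eq_iff)

lemma boundary_eq_sum:
  "boundary K c = (\<Sum>\<sigma>\<in>K. chain_scale (c \<sigma>) (face_boundary \<sigma>))"
proof -
  have "(\<Sum>\<sigma>\<in>K. chain_scale (c \<sigma>) (face_boundary \<sigma>)) \<tau> = (\<Sum>\<sigma>\<in>K. c \<sigma> * face_boundary \<sigma> \<tau>)" for \<tau>
    by (induction K rule: infinite_finite_induct) (auto simp: chain_scale_def)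
  then show ?thesis
    by (auto simp: boundary_def fun_eq_iff)
qed

lemma subspace_boundary_chains:
  "chain.subspace (boundary K ` chains K j :: ('v set \<Rightarrow> 'k::field) set)"
proof (rule chain.subspaceI)
  show "0 \<in> boundary K ` chains K j"
    using boundary_zero[of K] chain.subspace_0[OF subspace_chains] by (metis image_eqI)
next
  fix x y :: "'v set \<Rightarrow> 'k" assume "x \<in> boundary K ` chains K j" "y \<in> boundary K ` chains K j"
  then obtain c c' where c: "c \<in> chains K j" "c' \<in> chains K j" "x = boundary K c" "y = boundary K c'"
    by blast
  then have "x + y = boundary K (c + c')"
    by (simp only: boundary_add)
  then show "x + y \<in> boundary K ` chains K j"
    using chain.subspace_add[OF subspace_chains c(1,2)] by (rule image_eqI)
next
  fix a and x :: "'v set \<Rightarrow> 'k" assume "x \<in> boundary K ` chains K j"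
  then obtain c where c: "c \<in> chains K j" "x = boundary K c"
    by blast
  then have "chain_scale a x = boundary K (chain_scale a c)"
    by (simp only: boundary_scale)
  then show "chain_scale a x \<in> boundary K ` chains K j"
    using chain.subspace_scale[OF subspace_chains c(1)] by (rule image_eqI)
qed

lemma subspace_cycles:
  "chain.subspace (cycles K j :: ('v set \<Rightarrow> 'k::field) set)"
proof (rule chain.subspaceI)
  show "0 \<in> cycles K j"
    using boundary_zero[of K] chain.subspace_0[OF subspace_chains, of K j]
    by (simp add: cycles_def zero_fun_def)
next
  fix x y :: "'v set \<Rightarrow> 'k" assume "x \<in> cycles K j" "y \<in> cycles K j"
  then show "x + y \<in> cycles K j"
    using chain.subspace_add[OF subspace_chains, of x K j y] boundary_add[of K x y]
    by (simp add: cycles_def plus_fun_def)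
next
  fix a and x :: "'v set \<Rightarrow> 'k" assume "x \<in> cycles K j"
  then show "chain_scale a x \<in> cycles K j"
    using chain.subspace_scale[OF subspace_chains, of x K j a]
    by (simp add: cycles_def boundary_scale) (simp add: chain_scale_def)
qed

lemma faces_insert_empty: "j \<ge> 0 \<Longrightarrow> faces (insert {} K) j = faces K j"
  by (auto simp: faces_def face_dim_def)

lemma elementary_chain_in_chains: "\<sigma> \<in> faces K j \<Longrightarrow> elementary_chain \<sigma> \<in> chains K j"
  by (auto simp: elementary_chain_def chains_def faces_def)

lemma boundary_elementary_chain:
  assumes "finite K" "\<sigma> \<in> K"
  shows "boundary K (elementary_chain \<sigma>) = face_boundary \<sigma>"
proof
  fix \<tau>
  have "boundary K (elementary_chain \<sigma>) \<tau> = (\<Sum>\<sigma>'\<in>K. if \<sigma>' = \<sigma> then face_boundary \<sigma>' \<tau> else 0)"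
    unfolding boundary_def elementary_chain_def by (rule sum.cong) auto
  also have "\<dots> = face_boundary \<sigma> \<tau>"
    using assms by (simp add: sum.delta)
  finally show "boundary K (elementary_chain \<sigma>) \<tau> = face_boundary \<sigma> \<tau>" .
qed

lemma boundary_chains_eq_span:
  assumes "finite K" "j \<ge> 0"
  shows "boundary K ` chains K j = (chain.span (face_boundary ` faces K j) :: ('v set \<Rightarrow> 'k::field) set)"
proof
  show "boundary K ` chains K j \<subseteq> (chain.span (face_boundary ` faces K j) :: ('v set \<Rightarrow> 'k) set)"
  proof
    fix b :: "'v set \<Rightarrow> 'k"
    assume "b \<in> boundary K ` chains K j"
    then obtain c where c: "c \<in> chains K j" "b = boundary K c"
      by blast
    have "chain_scale (c \<sigma>) (face_boundary \<sigma>) \<in> chain.span (face_boundary ` faces K j)" for \<sigma>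
    proof (cases "c \<sigma> = 0")
      case True
      then show ?thesis
        using chain.span_zero by simp
    next
      case False
      then have "\<sigma> \<in> faces K j"
        using c(1) assms(2) by (auto simp: chains_def faces_insert_empty)
      then show ?thesis
        by (intro chain.span_scale chain.span_base imageI)
    qed
    then show "b \<in> chain.span (face_boundary ` faces K j)"
      unfolding c(2) boundary_eq_sum by (intro chain.span_sum)
  qed
next
  show "(chain.span (face_boundary ` faces K j) :: ('v set \<Rightarrow> 'k) set) \<subseteq> boundary K ` chains K j"
  proof (rule chain.span_minimal[OF _ subspace_boundary_chains])
    show "(face_boundary :: 'v set \<Rightarrow> 'v set \<Rightarrow> 'k) ` faces K j \<subseteq> boundary K ` chains K j"
    proof (rule image_subsetI)
      fix \<sigma> :: "'v set" assume "\<sigma> \<in> faces K j"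
      moreover from this have "\<sigma> \<in> K"
        by (simp add: faces_def)
      ultimately show "(face_boundary \<sigma> :: 'v set \<Rightarrow> 'k) \<in> boundary K ` chains K j"
        using boundary_elementary_chain[OF assms(1)] elementary_chain_in_chains by (metis image_eqI)
    qed
  qed
qed

lemma dim_boundaries:
  assumes "finite K" "j \<ge> -1"
  shows "chain.dim (boundaries K j :: ('v set \<Rightarrow> 'k::field) set) = boundary_rank TYPE('k) (faces K (j + 1))"
  using assms by (simp add: boundaries_def boundary_chains_eq_span boundary_rank_def)

lemma chains_subset_span:
  assumes "finite K"
  shows "chains K j \<subseteq> chain.span (elementary_chain ` insert {} K)"
proof
  fix c :: "'a set \<Rightarrow> 'b"
  assume c: "c \<in> chains K j"
  have "(\<Sum>\<sigma>\<in>F. chain_scale (c \<sigma>) (elementary_chain \<sigma>)) \<tau> = (if \<tau> \<in> F then c \<tau> else 0)"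
    if "finite F" for F \<tau>
    using that by (induction F) (auto simp: chain_scale_def elementary_chain_def)
  then have "(\<Sum>\<sigma>\<in>insert {} K. chain_scale (c \<sigma>) (elementary_chain \<sigma>)) \<tau> = c \<tau>" for \<tau>
    using c assms finite_insert[of "{}" K] by (auto simp: chains_def faces_def)
  then have "c = (\<Sum>\<sigma>\<in>insert {} K. chain_scale (c \<sigma>) (elementary_chain \<sigma>))"
    by (simp add: fun_eq_iff)
  then show "c \<in> chain.span (elementary_chain ` insert {} K)"
    by (metis (no_types, lifting) chain.span_base chain.span_scale chain.span_sum imageI)
qed

text \<open>The effect on homology of adding one face \<open>\<sigma>\<close> of dimension \<open>d \<ge> 1\<close>. Neither \<open>K\<close> nor the
  enlarged set has to be closed under taking faces, because Betti numbers are differences of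
  dimensions that make sense for every finite set of faces. The condition \<open>d \<ge> 1\<close> keeps the empty
  face out of the degrees \<open>d - 1\<close> and \<open>d\<close>.\<close>

context
  fixes K :: "'v set set" and \<sigma> :: "'v set" and d :: int
  assumes K: "finite K" "\<sigma> \<notin> K" and d: "face_dim \<sigma> = d" "d \<ge> 1"
begin

lemma faces_insert_face: "faces (insert \<sigma> K) j = (if j = d then insert \<sigma> (faces K j) else faces K j)"
  using d by (auto simp: faces_def)

lemma boundary_insert_face:
  "boundary (insert \<sigma> K) c = boundary K c + chain_scale (c \<sigma>) (face_boundary \<sigma>)"
  using K by (auto simp: boundary_def chain_scale_def fun_eq_iff)

lemma chain_on_new_face_eq_0: "c \<in> chains K j \<Longrightarrow> c \<sigma> = 0"
  using K d by (auto simp: chains_def faces_def face_dim_def)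

lemma chains_insert_face:
  "c \<in> chains (insert \<sigma> K) j \<longleftrightarrow> c \<in> chains K j \<or> j = d \<and> c - chain_scale (c \<sigma>) (elementary_chain \<sigma>) \<in> chains K j"
proof -
  have *: "faces (insert {} (insert \<sigma> K)) j = (if j = d then insert \<sigma> (faces (insert {} K) j) else faces (insert {} K) j)"
    using d by (auto simp: faces_def)
  show ?thesis
    unfolding chains_def * by (auto simp: chain_scale_def elementary_chain_def)
qed

lemma cycles_insert_face_other:
  assumes "j \<noteq> d"
  shows "cycles (insert \<sigma> K) j = cycles K j"
  using assms by (auto simp: cycles_def chains_insert_face boundary_insert_face chain_on_new_face_eq_0)

lemma boundaries_insert_face_other:
  assumes "j \<noteq> d - 1"
  shows "boundaries (insert \<sigma> K) j = (boundaries K j :: ('v set \<Rightarrow> 'k::field) set)"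
proof -
  have "chains (insert \<sigma> K) (j + 1) = (chains K (j + 1) :: ('v set \<Rightarrow> 'k) set)"
    using assms by (auto simp: chains_insert_face)
  moreover have "boundary (insert \<sigma> K) c = boundary K c" if "c \<in> chains K (j + 1)"
    for c :: "'v set \<Rightarrow> 'k"
    using that by (simp add: boundary_insert_face chain_on_new_face_eq_0)
  ultimately show ?thesis
    by (simp add: boundaries_def cong: image_cong)
qed

text \<open>Only the boundaries in degree \<open>d - 1\<close> change.\<close>

lemma betti_below_insert_face:
  "betti TYPE('k::field) (insert \<sigma> K) (d - 1) = betti TYPE('k) K (d - 1) - 1 \<longleftrightarrow>
   boundary_rank TYPE('k) (insert \<sigma> (faces K d)) = Suc (boundary_rank TYPE('k) (faces K d))"
  using K d by (auto simp: betti_def cycles_insert_face_other dim_boundaries faces_insert_face)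

text \<open>A new cycle exists exactly if the boundary of \<open>\<sigma>\<close> is already a boundary; it is \<open>\<sigma>\<close> minus a
  chain with the same boundary.\<close>

lemma dim_cycles_insert_face:
  "chain.dim (cycles (insert \<sigma> K) d :: ('v set \<Rightarrow> 'k::field) set) =
   (if (face_boundary \<sigma> :: 'v set \<Rightarrow> 'k) \<in> chain.span (face_boundary ` faces K d)
    then Suc (chain.dim (cycles K d :: ('v set \<Rightarrow> 'k) set)) else chain.dim (cycles K d :: ('v set \<Rightarrow> 'k) set))"
proof -
  have image: "boundary K ` chains K d = chain.span (face_boundary ` faces K d :: ('v set \<Rightarrow> 'k) set)"
    using K d by (simp add: boundary_chains_eq_span)
  have sub: "cycles K d \<subseteq> (cycles (insert \<sigma> K) d :: ('v set \<Rightarrow> 'k) set)"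
    by (auto simp: cycles_def chains_insert_face boundary_insert_face chain_on_new_face_eq_0)
  have e: "boundary K (elementary_chain \<sigma> :: 'v set \<Rightarrow> 'k) = 0"
    using K by (auto simp: boundary_def elementary_chain_def fun_eq_iff intro!: sum.neutral)
  show ?thesis
  proof (cases "(face_boundary \<sigma> :: 'v set \<Rightarrow> 'k) \<in> chain.span (face_boundary ` faces K d)")
    case True
    then obtain z :: "'v set \<Rightarrow> 'k" where z: "z \<in> chains K d" "boundary K z = face_boundary \<sigma>"
      unfolding image[symmetric] by (metis imageE)
    \<comment> \<open>The new cycle; since its coefficient at \<open>\<sigma>\<close> is \<open>1\<close>, it spans a complement of the old
      ones.\<close>
    define z' where "z' = elementary_chain \<sigma> - z"
    have z'\<sigma>: "z' \<sigma> = 1"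
      using chain_on_new_face_eq_0[OF z(1)] by (simp add: z'_def elementary_chain_def)
    have z_minus: "boundary K (- z) = - face_boundary \<sigma>"
      using z(2) by (auto simp: boundary_def fun_eq_iff sum_negf)
    have "boundary K z' = - face_boundary \<sigma>"
      using boundary_add[of K "elementary_chain \<sigma>" "- z"] e z_minus by (simp add: z'_def)
    then have bz': "boundary (insert \<sigma> K) z' = 0"
      by (simp add: boundary_insert_face z'\<sigma>)
    have "z' - chain_scale (z' \<sigma>) (elementary_chain \<sigma>) = - z"
      unfolding z'\<sigma> by (simp add: z'_def)
    then have "z' \<in> chains (insert \<sigma> K) d"
      using chain.subspace_neg[OF subspace_chains z(1)] by (simp add: chains_insert_face)
    then have z'_cycle: "z' \<in> cycles (insert \<sigma> K) d"
      using bz' by (simp add: cycles_def zero_fun_def)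
    have "cycles (insert \<sigma> K) d \<subseteq> chain.span (insert z' (cycles K d))"
    proof
      fix c :: "'v set \<Rightarrow> 'k"
      assume c: "c \<in> cycles (insert \<sigma> K) d"
      define c' where "c' = c - chain_scale (c \<sigma>) z'"
      have c': "c' \<in> cycles (insert \<sigma> K) d"
        unfolding c'_def by (intro chain.subspace_diff chain.subspace_scale subspace_cycles c z'_cycle)
      have "c' \<sigma> = 0"
        by (simp add: c'_def chain_scale_def z'\<sigma>)
      then have "c' \<in> cycles K d"
        using c' by (auto simp: cycles_def chains_insert_face boundary_insert_face)
      moreover have "c = chain_scale (c \<sigma>) z' + c'"
        by (simp add: c'_def)
      ultimately show "c \<in> chain.span (insert z' (cycles K d))"
        by (metis chain.span_add chain.span_base chain.span_scale insertI1 insertI2)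
    qed
    moreover have "insert z' (cycles K d) \<subseteq> cycles (insert \<sigma> K) d"
      using sub z'_cycle by blast
    ultimately have "cycles (insert \<sigma> K) d = chain.span (insert z' (cycles K d))"
      by (metis chain.span_minimal subspace_cycles subset_antisym)
    then have "chain.dim (cycles (insert \<sigma> K) d :: ('v set \<Rightarrow> 'k) set) = chain.dim (insert z' (cycles K d))"
      using chain.dim_span[of "insert z' (cycles K d)"] by simp
    moreover have "z' \<notin> chain.span (cycles K d)"
    proof -
      have "z' \<notin> cycles K d"
        using z'\<sigma> chain_on_new_face_eq_0[of z' d] by (auto simp: cycles_def)
      then show ?thesis
        using chain.span_eq_iff subspace_cycles by blast
    qed
    moreover have "cycles K d \<subseteq> chain.span (elementary_chain ` insert {} K :: ('v set \<Rightarrow> 'k) set)"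
      using chains_subset_span[OF K(1), of d] by (auto simp: cycles_def)
    ultimately show ?thesis
      using True dim_insert_finite_span[of "elementary_chain ` insert {} K" "cycles K d" z'] K by simp
  next
    case False
    have "c \<in> cycles K d" if c: "c \<in> cycles (insert \<sigma> K) d" for c :: "'v set \<Rightarrow> 'k"
    proof -
      have "c \<sigma> = 0"
      proof (rule ccontr)
        assume "c \<sigma> \<noteq> 0"
        define c' where "c' = c - chain_scale (c \<sigma>) (elementary_chain \<sigma>)"
        have "c \<notin> chains K d"
          using \<open>c \<sigma> \<noteq> 0\<close> chain_on_new_face_eq_0 by blast
        then have c': "c' \<in> chains K d"
          using c by (auto simp: cycles_def chains_insert_face c'_def)
        have "boundary K c = boundary K (c' + chain_scale (c \<sigma>) (elementary_chain \<sigma>))"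
          by (simp add: c'_def)
        also have "\<dots> = boundary K c'"
          by (simp add: boundary_add boundary_scale e)
        finally have "boundary K c' + chain_scale (c \<sigma>) (face_boundary \<sigma>) = 0"
          using c by (simp add: cycles_def boundary_insert_face zero_fun_def)
        then have "chain_scale (c \<sigma>) (face_boundary \<sigma>) = - boundary K c'"
          by (simp add: eq_neg_iff_add_eq_0 add.commute)
        moreover have "- boundary K c' \<in> boundary K ` chains K d"
          using c' chain.subspace_neg[OF subspace_boundary_chains] by blast
        ultimately have "chain_scale (c \<sigma>) (face_boundary \<sigma>) \<in> chain.span (face_boundary ` faces K d)"
          using image by simp
        then have "chain_scale (inverse (c \<sigma>)) (chain_scale (c \<sigma>) (face_boundary \<sigma>)) \<in> chain.span (face_boundary ` faces K d)"
          by (rule chain.span_scale)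
        then show False
          using False \<open>c \<sigma> \<noteq> 0\<close> by simp
      qed
      then show ?thesis
        using c by (auto simp: cycles_def chains_insert_face boundary_insert_face)
    qed
    then have "cycles (insert \<sigma> K) d = (cycles K d :: ('v set \<Rightarrow> 'k) set)"
      using sub by blast
    then show ?thesis
      using False by simp
  qed
qed

text \<open>Only the cycles in degree \<open>d\<close> change.\<close>

lemma betti_insert_face:
  "betti TYPE('k::field) (insert \<sigma> K) d = betti TYPE('k) K d + 1 \<longleftrightarrow>
   boundary_nullity TYPE('k) (insert \<sigma> (faces K d)) = Suc (boundary_nullity TYPE('k) (faces K d))"
proof -
  have "finite (faces K d)" "\<sigma> \<notin> faces K d"
    using K by (auto simp: faces_def)
  then show ?thesis
    using boundaries_insert_face_other[of d, where 'k='k]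
    by (simp add: betti_def dim_cycles_insert_face boundary_nullity_insert)
qed

end


section \<open>Birth and death times as level multisets\<close>

lemma span_boundary_mono:
  "A \<subseteq> B \<Longrightarrow> chain.span (face_boundary ` A) \<subseteq> chain.span (face_boundary ` B)"
  by (intro chain.span_mono image_mono)

lemma unit_increasing_boundary_rank: "unit_increasing (boundary_rank TYPE('k::field) :: 'v set set \<Rightarrow> nat)"
  by (simp add: unit_increasing_def boundary_rank_empty boundary_rank_insert)

lemma unit_increasing_boundary_nullity: "unit_increasing (boundary_nullity TYPE('k::field) :: 'v set set \<Rightarrow> nat)"
  unfolding unit_increasing_def
proof (intro conjI allI impI)
  fix A :: "'v set set" and \<sigma> assume "finite A"
  then show "boundary_nullity TYPE('k) A \<le> boundary_nullity TYPE('k) (insert \<sigma> A)"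
    "boundary_nullity TYPE('k) (insert \<sigma> A) \<le> Suc (boundary_nullity TYPE('k) A)"
    by (cases "\<sigma> \<in> A"; simp add: insert_absorb boundary_nullity_insert)+
qed (simp add: boundary_nullity_empty)

lemma submodular_boundary_rank: "submodular (boundary_rank TYPE('k::field) :: 'v set set \<Rightarrow> nat)"
  unfolding submodular_def
proof (intro allI impI)
  fix A B :: "'v set set" and \<sigma> assume "finite B" "A \<subseteq> B" "\<sigma> \<notin> B"
  then show "boundary_rank TYPE('k) (insert \<sigma> B) + boundary_rank TYPE('k) A
      \<le> boundary_rank TYPE('k) (insert \<sigma> A) + boundary_rank TYPE('k) B"
    using span_boundary_mono[of A B, where 'b='k] finite_subset[of A B]
    by (auto simp: boundary_rank_insert)
qed

lemma supermodular_boundary_nullity: "supermodular (boundary_nullity TYPE('k::field) :: 'v set set \<Rightarrow> nat)"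
  unfolding supermodular_def
proof (intro allI impI)
  fix A B :: "'v set set" and \<sigma> assume *: "finite B" "A \<subseteq> B" "\<sigma> \<notin> B"
  then have "finite A" "\<sigma> \<notin> A"
    using finite_subset by auto
  with * show "boundary_nullity TYPE('k) (insert \<sigma> A) + boundary_nullity TYPE('k) B
      \<le> boundary_nullity TYPE('k) (insert \<sigma> B) + boundary_nullity TYPE('k) A"
    using span_boundary_mono[of A B, where 'b='k]
    by (auto simp: boundary_nullity_insert)
qed

text \<open>A list of all faces is handled through the set function that ignores the faces of other
  dimensions; it can only jump at \<open>d\<close>-faces.\<close>

lemma jumps_eq_selected_faces:
  assumes L: "distinct L" and \<rho>: "unit_increasing \<rho>"
    and iff: "\<And>i. i < length L \<Longrightarrow> face_dim (L ! i) = d \<Longrightarrow>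
      P i \<longleftrightarrow> \<rho> (insert (L ! i) (faces (set (take i L)) d)) = Suc (\<rho> (faces (set (take i L)) d))"
  shows "{L ! i | i. i < length L \<and> face_dim (L ! i) = d \<and> P i} = jumps (\<lambda>A. \<rho> (faces A d)) L"
proof -
  have "face_dim (L ! i) = d \<and> P i \<longleftrightarrow>
      \<rho> (faces (set (take (Suc i) L)) d) = Suc (\<rho> (faces (set (take i L)) d))" if "i < length L" for i
  proof -
    have "faces (set (take (Suc i) L)) d = (if face_dim (L ! i) = d
        then insert (L ! i) (faces (set (take i L)) d) else faces (set (take i L)) d)"
      using that by (auto simp: take_Suc_conv_app_nth faces_def)
    then show ?thesis
      using iff[OF that] by auto
  qed
  then show ?thesis
    unfolding jumps_def by blast
qed

lemma level_multiset_face_order: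
  assumes L: "face_order K w L" and \<rho>: "unit_increasing \<rho>"
  shows "level_multiset \<rho> (faces K d) w (image_mset w (mset_set (jumps (\<lambda>A. \<rho> (faces A d)) L)))"
proof -
  have insert: "faces (insert \<sigma> A) d = (if face_dim \<sigma> = d then insert \<sigma> (faces A d) else faces A d)" for \<sigma> :: "'a set" and A
    by (auto simp: faces_def)
  have finite: "finite A \<Longrightarrow> finite (faces A d)" for A :: "'a set set"
    by (simp add: faces_def)
  have "unit_increasing (\<lambda>A. \<rho> (faces A d))"
    using \<rho> finite unfolding unit_increasing_def insert by (auto simp: faces_def[of "{}"])
  then have level: "level_multiset (\<lambda>A. \<rho> (faces A d)) K w (image_mset w (mset_set (jumps (\<lambda>A. \<rho> (faces A d)) L)))"
  proof (rule level_multiset_jumps)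
    show "distinct L" "set L = K"
      using L by (auto simp: face_order_def)
    fix i j assume "i < j" "j < length L"
    show "w (L ! i) \<le> w (L ! j)"
    proof (rule ccontr)
      assume "\<not> w (L ! i) \<le> w (L ! j)"
      then have "w (L ! j) < w (L ! i)"
        by simp
      moreover have "i < length L"
        using \<open>i < j\<close> \<open>j < length L\<close> by simp
      ultimately have "j < i"
        using L \<open>j < length L\<close> unfolding face_order_def by blast
      then show False
        using \<open>i < j\<close> by simp
    qed
  qed
  show ?thesis
    unfolding level_multiset_def
  proof (intro allI impI)
    fix Q :: "real \<Rightarrow> bool" assume "antimono Q"
    have "faces {\<sigma> \<in> K. Q (w \<sigma>)} d = {\<sigma> \<in> faces K d. Q (w \<sigma>)}"
      by (auto simp: faces_def)
    moreover have "size (filter_mset Q (image_mset w (mset_set (jumps (\<lambda>A. \<rho> (faces A d)) L))))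
        = \<rho> (faces {\<sigma> \<in> K. Q (w \<sigma>)} d)"
      using level \<open>antimono Q\<close> unfolding level_multiset_def by blast
    ultimately show "size (filter_mset Q (image_mset w (mset_set (jumps (\<lambda>A. \<rho> (faces A d)) L))))
        = \<rho> {\<sigma> \<in> faces K d. Q (w \<sigma>)}"
      by (simp only:)
  qed
qed

lemma prefix_complex:
  assumes "distinct L" "i < length L"
  shows "set (take (Suc i) L) = insert (L ! i) (set (take i L))" "L ! i \<notin> set (take i L)"
proof -
  show "set (take (Suc i) L) = insert (L ! i) (set (take i L))"
    using assms(2) by (simp add: take_Suc_conv_app_nth)
  have "distinct (take (Suc i) L)"
    using assms(1) by simp
  then show "L ! i \<notin> set (take i L)"
    using assms(2) by (simp add: take_Suc_conv_app_nth)
qed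

text \<open>Negative faces are the greedy basis of the boundary matroid, and positive faces are the
  remaining ones.\<close>

lemma negative_faces_eq_jumps:
  assumes "distinct L" "d \<ge> 1"
  shows "negative_faces TYPE('k::field) L d = jumps (\<lambda>A. boundary_rank TYPE('k) (faces A d)) L"
  unfolding negative_faces_def
  by (rule jumps_eq_selected_faces[OF assms(1) unit_increasing_boundary_rank])
    (simp add: prefix_complex assms betti_below_insert_face)

lemma positive_faces_eq_jumps:
  assumes "distinct L" "d \<ge> 1"
  shows "positive_faces TYPE('k::field) L d = jumps (\<lambda>A. boundary_nullity TYPE('k) (faces A d)) L"
  unfolding positive_faces_def
  by (rule jumps_eq_selected_faces[OF assms(1) unit_increasing_boundary_nullity])
    (simp add: prefix_complex assms betti_insert_face)

lemma level_multiset_death_times: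
  assumes "face_order K w L" "d \<ge> 1"
  shows "level_multiset (boundary_rank TYPE('k::field)) (faces K d) w (death_times TYPE('k) w L (d - 1))"
proof -
  have "distinct L"
    using assms(1) by (simp add: face_order_def)
  then show ?thesis
    using level_multiset_face_order[OF assms(1) unit_increasing_boundary_rank] assms(2)
    by (simp add: death_times_def negative_faces_eq_jumps)
qed

lemma level_multiset_birth_times:
  assumes "face_order K w L" "d \<ge> 1"
  shows "level_multiset (boundary_nullity TYPE('k::field)) (faces K d) w (birth_times TYPE('k) w L d)"
proof -
  have "distinct L"
    using assms(1) by (simp add: face_order_def)
  then show ?thesis
    using level_multiset_face_order[OF assms(1) unit_increasing_boundary_nullity] assms(2)
    by (simp add: birth_times_def positive_faces_eq_jumps)
qed

theorem theorem1p4: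
  fixes K :: "'v set set"
    and f f' :: "'v set \<Rightarrow> real"
    and L L' :: "'v set list"
    and d :: nat
    and p :: enat
  assumes "d \<ge> 1"
    and "simplicial_complex K"
    and "monotone_weight K f" and "monotone_weight K f'"
    and "face_order K f L" and "face_order K f' L'"
  shows "max
      (matching_cost p (death_times TYPE('k::field) f L (int d - 1))
                       (death_times TYPE('k) f' L' (int d - 1)))
      (matching_cost p (birth_times TYPE('k) f L (int d))
                       (birth_times TYPE('k) f' L' (int d)))
    \<le> power_sum p (faces K (int d)) (\<lambda>\<sigma>. f \<sigma> - f' \<sigma>)"
proof (rule max.boundedI)
  have S: "finite (faces K (int d))" and d: "int d \<ge> 1"
    using assms(1,2) by (auto simp: simplicial_complex_def faces_def)
  show "matching_cost p (death_times TYPE('k) f L (int d - 1)) (death_times TYPE('k) f' L' (int d - 1))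
      \<le> power_sum p (faces K (int d)) (\<lambda>\<sigma>. f \<sigma> - f' \<sigma>)"
    by (rule matching_cost_level_multisets[where \<rho> = "boundary_rank TYPE('k)", OF unit_increasing_boundary_rank disjI1[OF submodular_boundary_rank] S])
      (intro level_multiset_death_times d assms)+
  show "matching_cost p (birth_times TYPE('k) f L (int d)) (birth_times TYPE('k) f' L' (int d))
      \<le> power_sum p (faces K (int d)) (\<lambda>\<sigma>. f \<sigma> - f' \<sigma>)"
    by (rule matching_cost_level_multisets[where \<rho> = "boundary_nullity TYPE('k)", OF unit_increasing_boundary_nullity disjI2[OF supermodular_boundary_nullity] S])
      (intro level_multiset_birth_times d assms)+
qed

end
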